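(* Let $n\ge1$, let $f\colon\{0,1\}^n\to\{-1,+1\}$ be given, and let $d=\deg(f)$. Put $F_1=[f(x\wedge y)]_{x,y}$ and $F_2=[f(x\vee y)]_{x,y}$, where the row index $x$ and the column index $y$ range over $\{0,1\}^n$. Then $$\max\{\operatorname{rk}F_1,\ \operatorname{rk}F_2\}\;\ge\;\left(\frac{3}{2\sqrt2}\right)^d\;\ge\;1.06^d.$$ In particular, the communication problem $F$ of computing, on input $x,y\in\{0,1\}^n$, both of the quantities $f(x\wedge y)$ and $f(x\vee y)$ satisfies the log-rank conjecture, i.e. $D(F)\le(\log_2\operatorname{rk}F)^c+c$ for some absolute constant $c>0$ (independent of $n$ and $f$).
   Context: The operations $x\wedge y$, $x\vee y$ are bitwise AND and OR. The rank $\operatorname{rk}$ is over the reals. Degree: every function $f\colon\{0,1\}^n\to\mathbb{R}$ has a unique representation $f(x)=\sum_{S\subseteq\{1,\dots,n\}}\alpha_S\prod_{i\in S}x_i$ with real $\alpha_S$; $\deg(f)=\max\{|S|:\alpha_S\ne0\}$. The communication problem $F$ is expressed formally as a two-party function by introducing an additional input bit $b\in\{0,1\}$ indicating the desired output: $F((x,b),y)=f(x\wedge y)$ if $b=0$ and $F((x,b),y)=f(x\vee y)$ if $b=1$, where Alice holds $(x,b)$ and Bob holds $y$; $\operatorname{rk}F$ is the rank of the corresponding $\pm1$ matrix. $D(F)$ is the deterministic two-party communication complexity (least worst-case number of bits exchanged by a deterministic protocol computing $F$). *)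

theory Defs
  imports Complex_Main "Jordan_Normal_Form.DL_Rank"
begin

section \<open>The Boolean cube\<close>

text \<open>A point of the cube is a bit string of length \<open>n\<close>, with \<open>False\<close> for 0 and \<open>True\<close> for 1;
  its coordinates are numbered \<open>0, \<dots>, n - 1\<close>. The cube is a list rather than a set because
  the matrices below need an ordering of their rows and columns.\<close>

definition cube :: "nat \<Rightarrow> bool list list" where
  "cube n = List.n_lists n [False, True]"

lemma set_cube: "set (cube n) = {x. length x = n}"
  by (auto simp: cube_def set_n_lists)

definition bit_and :: "bool list \<Rightarrow> bool list \<Rightarrow> bool list" where
  "bit_and x y = map2 (\<and>) x y"

definition bit_or :: "bool list \<Rightarrow> bool list \<Rightarrow> bool list" where
  "bit_or x y = map2 (\<or>) x y"


section \<open>Degree\<close>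

definition multilinear_rep :: "nat \<Rightarrow> (bool list \<Rightarrow> real) \<Rightarrow> (nat set \<Rightarrow> real) \<Rightarrow> bool" where
  "multilinear_rep n f \<alpha> \<longleftrightarrow>
     (\<forall>S. \<not> S \<subseteq> {..<n} \<longrightarrow> \<alpha> S = 0) \<and>
     (\<forall>x\<in>set (cube n). f x = (\<Sum>S\<in>Pow {..<n}. \<alpha> S * (\<Prod>i\<in>S. of_bool (x ! i))))"

lemma multilinear_rep_ex1: "\<exists>!\<alpha>. multilinear_rep n f \<alpha>"
proof -
  define h where "h S = f (map (\<lambda>i. i \<in> S) [0..<n])" for S
  have mono: "(\<Prod>i\<in>T. of_bool (map (\<lambda>i. i \<in> S) [0..<n] ! i)) = (of_bool (T \<subseteq> S) :: real)"
    if "T \<subseteq> {..<n}" for S T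
  proof -
    have "finite T" using that finite_subset by blast
    have "(\<Prod>i\<in>T. of_bool (map (\<lambda>i. i \<in> S) [0..<n] ! i)) = (\<Prod>i\<in>T. of_bool (i \<in> S) :: real)"
      using that by (intro prod.cong) auto
    also have "\<dots> = of_bool (T \<subseteq> S)"
      using \<open>finite T\<close> by (cases "T \<subseteq> S") (auto simp: subset_iff intro!: prod.neutral)
    finally show ?thesis .
  qed
  have rep: "(\<Sum>T\<in>Pow {..<n}. \<alpha> T * (\<Prod>i\<in>T. of_bool (map (\<lambda>i. i \<in> S) [0..<n] ! i)))
      = sum \<alpha> (Pow (S \<inter> {..<n}))" for \<alpha> :: "nat set \<Rightarrow> real" and S
  proof -
    have "(\<Sum>T\<in>Pow {..<n}. \<alpha> T * (\<Prod>i\<in>T. of_bool (map (\<lambda>i. i \<in> S) [0..<n] ! i)))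
        = (\<Sum>T\<in>Pow {..<n}. if T \<subseteq> S then \<alpha> T else 0)"
      by (intro sum.cong) (auto simp: mono)
    also have "\<dots> = sum \<alpha> (Pow {..<n} \<inter> {T. T \<subseteq> S})"
      by (simp add: sum.inter_restrict)
    also have "Pow {..<n} \<inter> {T. T \<subseteq> S} = Pow (S \<inter> {..<n})" by auto
    finally show ?thesis .
  qed
  have points: "\<exists>S. S \<subseteq> {..<n} \<and> x = map (\<lambda>i. i \<in> S) [0..<n]" if "x \<in> set (cube n)" for x
    using that
    by (intro exI[of _ "{i. i < n \<and> x ! i}"]) (auto simp: set_cube intro!: nth_equalityI)
  have in_cube: "map (\<lambda>i. i \<in> S) [0..<n] \<in> set (cube n)" for S
    by (simp add: set_cube)
  have eq: "sum \<alpha> (Pow (S \<inter> {..<n})) = h S" if "multilinear_rep n f \<alpha>" for \<alpha> S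
    using that in_cube[of S] rep[of \<alpha> S] unfolding multilinear_rep_def h_def by metis
  show ?thesis
  proof (rule ex_ex1I)
    define b where "b S = (\<Sum>T\<in>Pow S. (-1) ^ card T * h T)" for S
    have inv: "h S = (\<Sum>T\<in>Pow S. (-1) ^ card T * b T)" if "finite S" for S
      using b_def that by (rule inclusion_exclusion_symmetric)
    define \<alpha> where "\<alpha> T = (if T \<subseteq> {..<n} then (-1) ^ card T * b T else 0)" for T
    have "f x = (\<Sum>T\<in>Pow {..<n}. \<alpha> T * (\<Prod>i\<in>T. of_bool (x ! i)))"
      if x: "x \<in> set (cube n)" for x
    proof -
      obtain S where S: "S \<subseteq> {..<n}" "x = map (\<lambda>i. i \<in> S) [0..<n]" using points[OF x] by blast
      have "sum \<alpha> (Pow (S \<inter> {..<n})) = (\<Sum>T\<in>Pow S. (-1) ^ card T * b T)"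
        using S(1) by (intro sum.cong) (auto simp: \<alpha>_def)
      also have "\<dots> = h S" using inv[OF finite_subset[OF S(1)]] by simp
      finally show ?thesis using rep[of \<alpha> S] by (simp add: S(2) h_def)
    qed
    then show "\<exists>\<alpha>. multilinear_rep n f \<alpha>"
      unfolding multilinear_rep_def by (intro exI[of _ \<alpha>]) (auto simp: \<alpha>_def)
  next
    fix \<alpha> \<beta> assume a: "multilinear_rep n f \<alpha>" and b: "multilinear_rep n f \<beta>"
    have full: "sum \<gamma> (Pow S) = h S" if "multilinear_rep n f \<gamma>" "finite S" for \<gamma> S
    proof -
      have "sum \<gamma> (Pow S) = sum \<gamma> (Pow (S \<inter> {..<n}))"
        using that by (intro sum.mono_neutral_right) (auto simp: multilinear_rep_def)
      then show ?thesis using eq that by simp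
    qed
    show "\<alpha> = \<beta>"
    proof
      fix S
      show "\<alpha> S = \<beta> S"
      proof (cases "S \<subseteq> {..<n}")
        case True
        then have fin: "finite S" using finite_subset by blast
        have "\<gamma> S = (\<Sum>T\<in>Pow S. (-1) ^ (card S - card T) * h T)" if "multilinear_rep n f \<gamma>" for \<gamma>
          using full[OF that, symmetric] fin by (rule inclusion_exclusion_mobius)
        then show ?thesis using a b by metis
      next
        case False
        then show ?thesis using a b by (simp add: multilinear_rep_def)
      qed
    qed
  qed
qed

definition multilinear_coeff :: "nat \<Rightarrow> (bool list \<Rightarrow> real) \<Rightarrow> nat set \<Rightarrow> real" where
  "multilinear_coeff n f = (THE \<alpha>. multilinear_rep n f \<alpha>)"

text \<open>Unspecified when \<open>f\<close> vanishes on the whole cube.\<close>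

definition cube_degree :: "nat \<Rightarrow> (bool list \<Rightarrow> real) \<Rightarrow> nat" where
  "cube_degree n f = Max {card S | S. multilinear_coeff n f S \<noteq> 0}"


section \<open>Rank of a two-party function\<close>

definition comm_matrix :: "'x list \<Rightarrow> 'y list \<Rightarrow> ('x \<Rightarrow> 'y \<Rightarrow> real) \<Rightarrow> real mat" where
  "comm_matrix xs ys g = mat (length xs) (length ys) (\<lambda>(i, j). g (xs ! i) (ys ! j))"

definition comm_rank :: "'x list \<Rightarrow> 'y list \<Rightarrow> ('x \<Rightarrow> 'y \<Rightarrow> real) \<Rightarrow> nat" where
  "comm_rank xs ys g = vec_space.rank (length xs) (comm_matrix xs ys g)"


section \<open>Deterministic communication complexity\<close>

text \<open>At an inner node the named player announces one bit computed from their own input;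
  \<open>False\<close> leads to the first subtree and \<open>True\<close> to the second. A leaf carries the output,
  which is thus determined by the transcript.\<close>

datatype ('x, 'y, 'o) protocol =
    Output 'o
  | Alice "'x \<Rightarrow> bool" "('x, 'y, 'o) protocol" "('x, 'y, 'o) protocol"
  | Bob "'y \<Rightarrow> bool" "('x, 'y, 'o) protocol" "('x, 'y, 'o) protocol"

primrec run :: "('x, 'y, 'o) protocol \<Rightarrow> 'x \<Rightarrow> 'y \<Rightarrow> 'o" where
  "run (Output z) x y = z"
| "run (Alice a P Q) x y = (if a x then run Q x y else run P x y)"
| "run (Bob b P Q) x y = (if b y then run Q x y else run P x y)"

primrec cost :: "('x, 'y, 'o) protocol \<Rightarrow> nat" where
  "cost (Output z) = 0"
| "cost (Alice a P Q) = Suc (max (cost P) (cost Q))"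
| "cost (Bob b P Q) = Suc (max (cost P) (cost Q))"

definition computes ::
  "('x, 'y, 'o) protocol \<Rightarrow> 'x set \<Rightarrow> 'y set \<Rightarrow> ('x \<Rightarrow> 'y \<Rightarrow> 'o) \<Rightarrow> bool" where
  "computes P X Y g \<longleftrightarrow> (\<forall>x\<in>X. \<forall>y\<in>Y. run P x y = g x y)"

definition comm_complexity :: "'x set \<Rightarrow> 'y set \<Rightarrow> ('x \<Rightarrow> 'y \<Rightarrow> 'o) \<Rightarrow> nat" where
  "comm_complexity X Y g = (LEAST k. \<exists>P. computes P X Y g \<and> cost P = k)"

lemma ex_computes:
  assumes "finite X" "finite Y"
  shows "\<exists>P. computes P X Y g"
  using assms(1)
proof (induction X rule: finite_induct)
  case empty
  then show ?case by (simp add: computes_def)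
next
  case (insert x X)
  then obtain P where P: "computes P X Y g" by blast
  have "\<exists>Q :: ('a, 'b, 'c) protocol. computes Q {x} Y g"
    using assms(2)
  proof (induction Y rule: finite_induct)
    case empty
    then show ?case by (simp add: computes_def)
  next
    case (insert y Y)
    then obtain Q :: "('a, 'b, 'c) protocol" where "computes Q {x} Y g" by blast
    then have "computes (Bob (\<lambda>z. z = y) Q (Output (g x y))) {x} (insert y Y) g"
      by (auto simp: computes_def)
    then show ?case by blast
  qed
  then obtain Q :: "('a, 'b, 'c) protocol" where "computes Q {x} Y g" by blast
  with P have "computes (Alice (\<lambda>z. z = x) P Q) (insert x X) Y g"
    by (auto simp: computes_def)
  then show ?case by blast
qed


section \<open>The AND/OR problem\<close>

text \<open>Alice holds \<open>(x, b)\<close>, where \<open>b\<close> selects the output, and Bob holds \<open>y\<close>.\<close>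

definition and_or_problem ::
  "(bool list \<Rightarrow> real) \<Rightarrow> bool list \<times> bool \<Rightarrow> bool list \<Rightarrow> real" where
  "and_or_problem f = (\<lambda>(x, b) y. if b then f (bit_or x y) else f (bit_and x y))"

definition alice_inputs :: "nat \<Rightarrow> (bool list \<times> bool) list" where
  "alice_inputs n = List.product (cube n) [False, True]"

end

theory Submission
  imports Defs "HOL-Computational_Algebra.Polynomial"
begin

text \<open>The rank of \<open>[f (x \<and> y)]\<close> is at least the number \<open>a\<close> of monomials of \<open>f\<close>, and that of
  \<open>[f (x \<or> y)]\<close> at least the number \<open>b\<close> of monomials of \<open>f\<close> written in the negated variables.
  Splitting off one variable, \<open>f = f\<^sub>0 + x \<Delta> = f\<^sub>1 - (1 - x) \<Delta>\<close>, gives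
  \<open>a(f) = a(f\<^sub>0) + a(\<Delta>)\<close> and \<open>b(f) = b(f\<^sub>1) + b(\<Delta>)\<close>; since \<open>f\<^sub>1 = f\<^sub>0 + \<Delta>\<close>, supports of
  sums yield by induction \<open>a b \<ge> 2^d\<close> for every real \<open>f\<close> of degree \<open>d\<close>, so one of the ranks is
  at least \<open>(sqrt 2)^d\<close>, and \<open>d\<close> is at most \<open>2 log (rk F)\<close>. Conversely the players simulate a decision
  tree for \<open>f\<close>, which has depth at most \<open>4 d^4\<close>: query all variables of a maximal family of
  disjoint monomials of degree \<open>d\<close>, after which the degree has dropped. Each of these monomials
  contains a sensitive block of \<open>f\<close> at \<open>0\<close>, so by a Markov-type inequality (Nisan and Szegedy)
  the family has at most \<open>4 d^2\<close> members.\<close>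

section \<open>Monomials of a function and of its complement\<close>

lemma card_Pow_insert_filter:
  assumes "finite U" "u \<notin> U"
  shows "card {S \<in> Pow (insert u U). P S}
       = card {S \<in> Pow U. P S} + card {S \<in> Pow U. P (insert u S)}"
proof -
  have "{S \<in> Pow (insert u U). P S} = {S \<in> Pow U. P S} \<union> insert u ` {S \<in> Pow U. P (insert u S)}"
    by (auto simp: Pow_insert)
  moreover have "card (insert u ` {S \<in> Pow U. P (insert u S)}) = card {S \<in> Pow U. P (insert u S)}"
    using assms by (intro card_image inj_onI) (auto simp: insert_ident)
  moreover have "{S \<in> Pow U. P S} \<inter> insert u ` {S \<in> Pow U. P (insert u S)} = {}"
    using assms by auto
  ultimately show ?thesis
    using assms(1) by (simp add: card_Un_disjoint)
qed

text \<open>Splitting off the variable \<open>u\<close>: an index set without \<open>u\<close> sees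
  the coefficients of the restriction to 1, one containing \<open>u\<close> only those of the
  difference of the two restrictions.\<close>

lemma sum_supersets_insert:
  fixes \<alpha> :: "'a set \<Rightarrow> real"
  assumes "finite U" "u \<notin> U" "T \<subseteq> U"
  shows "sum \<alpha> {S. T \<subseteq> S \<and> S \<subseteq> insert u U} = (\<Sum>S | T \<subseteq> S \<and> S \<subseteq> U. \<alpha> S + \<alpha> (insert u S))"
    and "sum \<alpha> {S. insert u T \<subseteq> S \<and> S \<subseteq> insert u U} = (\<Sum>S | T \<subseteq> S \<and> S \<subseteq> U. \<alpha> (insert u S))"
proof -
  let ?A = "{S. T \<subseteq> S \<and> S \<subseteq> U}"
  have fin: "finite ?A" using assms(1) by auto
  have inj: "inj_on (insert u) ?A" using assms by (intro inj_onI) (auto simp: insert_ident)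
  have eq: "{S. insert u T \<subseteq> S \<and> S \<subseteq> insert u U} = insert u ` ?A"
  proof (intro equalityI subsetI)
    fix S assume "S \<in> {S. insert u T \<subseteq> S \<and> S \<subseteq> insert u U}"
    then have "S = insert u (S - {u})" "S - {u} \<in> ?A" using assms by auto
    then show "S \<in> insert u ` ?A" by blast
  qed auto
  show 2: "sum \<alpha> {S. insert u T \<subseteq> S \<and> S \<subseteq> insert u U} = (\<Sum>S\<in>?A. \<alpha> (insert u S))"
    unfolding eq by (simp add: sum.reindex[OF inj])
  have "{S. T \<subseteq> S \<and> S \<subseteq> insert u U} = ?A \<union> {S. insert u T \<subseteq> S \<and> S \<subseteq> insert u U}"
    by auto
  moreover have "finite {S. insert u T \<subseteq> S \<and> S \<subseteq> insert u U}" unfolding eq using fin by (rule finite_imageI)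
  ultimately show "sum \<alpha> {S. T \<subseteq> S \<and> S \<subseteq> insert u U} = (\<Sum>S\<in>?A. \<alpha> S + \<alpha> (insert u S))"
    using fin assms(2)
    by (simp only: sum.distrib flip: 2) (rule sum.union_disjoint; auto)
qed

text \<open>Any occurring monomial is allowed, not only one of top size, because what is left after
  deleting \<open>u\<close> need not be maximal in the restricted functions. If \<open>u\<close>
  occurs, the remaining monomial lies in \<open>\<Delta>\<close> and in at least one of
  \<open>f\<^sub>0\<close> and \<open>f\<^sub>1\<close>; two induction hypotheses with a common
  bound on one factor supply the factor 2.\<close>

lemma support_uncertainty:
  fixes \<alpha> :: "'a set \<Rightarrow> real"
  assumes "finite U" "S\<^sub>0 \<subseteq> U" "\<alpha> S\<^sub>0 \<noteq> 0"
  shows "2 ^ card S\<^sub>0 \<le> card {S \<in> Pow U. \<alpha> S \<noteq> 0}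
    * card {T \<in> Pow U. sum \<alpha> {S. T \<subseteq> S \<and> S \<subseteq> U} \<noteq> 0}"
  using assms
proof (induction U arbitrary: S\<^sub>0 \<alpha> rule: finite_induct)
  case empty
  moreover have "{S \<in> Pow {}. \<alpha> S \<noteq> 0} = {{}}" using empty by auto
  moreover have "{S. T \<subseteq> S \<and> S \<subseteq> {}} = {{}}" if "T \<in> Pow {}" for T :: "'a set" using that by auto
  then have "{T \<in> Pow {}. sum \<alpha> {S. T \<subseteq> S \<and> S \<subseteq> {}} \<noteq> 0} = {{}}" using empty by auto
  ultimately show ?case by simp
next
  case (insert u U)
  let ?a = "\<lambda>\<alpha>::'a set \<Rightarrow> real. card {S \<in> Pow U. \<alpha> S \<noteq> 0}"
  let ?b = "\<lambda>\<alpha>::'a set \<Rightarrow> real. card {T \<in> Pow U. sum \<alpha> {S. T \<subseteq> S \<and> S \<subseteq> U} \<noteq> 0}"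
  \<comment> \<open>On subsets of \<open>U\<close> the families \<open>\<alpha>\<close>,
    \<open>\<delta>\<close> and \<open>\<sigma>\<close> are the coefficients of
    \<open>f\<^sub>0\<close>, \<open>\<Delta>\<close> and \<open>f\<^sub>1\<close>.\<close>
  define \<delta> where "\<delta> S = \<alpha> (insert u S)" for S
  define \<sigma> where "\<sigma> S = \<alpha> S + \<delta> S" for S
  have a: "card {S \<in> Pow (insert u U). \<alpha> S \<noteq> 0} = ?a \<alpha> + ?a \<delta>"
    using insert.hyps by (simp add: card_Pow_insert_filter \<delta>_def del: Pow_iff)
  have "{T \<in> Pow U. sum \<alpha> {S. T \<subseteq> S \<and> S \<subseteq> insert u U} \<noteq> 0}
      = {T \<in> Pow U. sum \<sigma> {S. T \<subseteq> S \<and> S \<subseteq> U} \<noteq> 0}"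
    "{T \<in> Pow U. sum \<alpha> {S. insert u T \<subseteq> S \<and> S \<subseteq> insert u U} \<noteq> 0}
      = {T \<in> Pow U. sum \<delta> {S. T \<subseteq> S \<and> S \<subseteq> U} \<noteq> 0}"
    using insert.hyps by (simp_all add: sum_supersets_insert \<sigma>_def \<delta>_def
      del: insert_subset cong: conj_cong)
  then have b: "card {T \<in> Pow (insert u U). sum \<alpha> {S. T \<subseteq> S \<and> S \<subseteq> insert u U} \<noteq> 0} = ?b \<sigma> + ?b \<delta>"
    by (simp only: card_Pow_insert_filter[OF insert.hyps])
  have split: "sum \<sigma> {S. T \<subseteq> S \<and> S \<subseteq> U} = sum \<alpha> {S. T \<subseteq> S \<and> S \<subseteq> U} + sum \<delta> {S. T \<subseteq> S \<and> S \<subseteq> U}" for T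
    by (simp add: \<sigma>_def sum.distrib)
  \<comment> \<open>The support of a sum lies in the union of the supports: applied to
    \<open>f\<^sub>1 = f\<^sub>0 + \<Delta>\<close> here and to
    \<open>f\<^sub>0 = f\<^sub>1 - \<Delta>\<close> for the superset sums.\<close>
  have a_le: "?a \<sigma> \<le> ?a \<alpha> + ?a \<delta>"
    by (rule order.trans[OF card_mono card_Un_le])
      (use insert.hyps in \<open>auto simp: \<sigma>_def\<close>)
  have b_le: "?b \<alpha> \<le> ?b \<sigma> + ?b \<delta>"
    by (rule order.trans[OF card_mono card_Un_le])
      (use insert.hyps in \<open>auto simp: split\<close>)
  have combine: "2 * X \<le> (a\<^sub>1 + a\<^sub>2) * b" if "X \<le> a\<^sub>1 * b\<^sub>1" "X \<le> a\<^sub>2 * b\<^sub>2" "b\<^sub>1 \<le> b" "b\<^sub>2 \<le> b"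
    for X a\<^sub>1 a\<^sub>2 b\<^sub>1 b\<^sub>2 b :: nat
    unfolding distrib_right
    using that(1,2) mult_le_mono2[OF that(3), of a\<^sub>1] mult_le_mono2[OF that(4), of a\<^sub>2] by linarith
  show ?case
  proof (cases "u \<in> S\<^sub>0")
    case False
    then have "2 ^ card S\<^sub>0 \<le> ?a \<alpha> * ?b \<alpha>" using insert.prems by (intro insert.IH) auto
    also have "\<dots> \<le> (?a \<alpha> + ?a \<delta>) * (?b \<sigma> + ?b \<delta>)" using b_le by (intro mult_le_mono) auto
    finally show ?thesis unfolding a b .
  next
    case True
    define S\<^sub>1 where "S\<^sub>1 = S\<^sub>0 - {u}"
    have S1: "S\<^sub>0 = insert u S\<^sub>1" "u \<notin> S\<^sub>1" "S\<^sub>1 \<subseteq> U" using True insert.prems by (auto simp: S\<^sub>1_def)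
    then have card: "2 ^ card S\<^sub>0 = 2 * 2 ^ card S\<^sub>1"
      using insert.hyps finite_subset by (metis card_insert_disjoint power_Suc)
    have \<delta>: "\<delta> S\<^sub>1 \<noteq> 0" using insert.prems S1 by (simp add: \<delta>_def)
    note IH = insert.IH[OF S1(3)]
    \<comment> \<open>If the coefficient vanishes in \<open>f\<^sub>0\<close>, it agrees in
      \<open>f\<^sub>1\<close> with that of \<open>\<Delta>\<close>. The first case bounds both
      superset counts by a common factor, the second both monomial counts.\<close>
    have "\<alpha> S\<^sub>1 \<noteq> 0 \<or> \<sigma> S\<^sub>1 \<noteq> 0" using \<delta> by (auto simp: \<sigma>_def)
    then show ?thesis
    proof
      assume "\<alpha> S\<^sub>1 \<noteq> 0"
      then show ?thesis unfolding a b card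
        using combine[OF IH[of \<alpha>] IH[of \<delta>]] b_le \<delta> by simp
    next
      assume "\<sigma> S\<^sub>1 \<noteq> 0"
      then have "2 * 2 ^ card S\<^sub>1 \<le> (?b \<sigma> + ?b \<delta>) * (?a \<alpha> + ?a \<delta>)"
        using combine[of "2 ^ card S\<^sub>1" "?b \<sigma>" "?a \<sigma>" "?b \<delta>" "?a \<delta>"] IH[of \<sigma>] IH[of \<delta>] a_le \<delta>
        by (simp add: mult.commute)
      then show ?thesis unfolding a b card by (simp add: mult.commute)
    qed
  qed
qed

section \<open>Rank\<close>

text \<open>The test vectors turn the matrix into a diagonal one with nonzero diagonal. The vectors
  \<open>v j\<close> lie in the column space, and pairing a linear relation among them with
  \<open>u i\<close> isolates the coefficient at \<open>i\<close>; hence they are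
  independent.\<close>

lemma comm_rank_ge_card:
  fixes g :: "'x \<Rightarrow> 'y \<Rightarrow> real" and u :: "'i \<Rightarrow> 'x \<Rightarrow> real" and w :: "'i \<Rightarrow> 'y \<Rightarrow> real"
  assumes dist: "distinct xs" "distinct ys" and "finite I"
    and diag: "\<And>i. i \<in> I \<Longrightarrow> (\<Sum>x\<in>set xs. \<Sum>y\<in>set ys. u i x * g x y * w i y) \<noteq> 0"
    and off: "\<And>i j. i \<in> I \<Longrightarrow> j \<in> I \<Longrightarrow> i \<noteq> j \<Longrightarrow>
      (\<Sum>x\<in>set xs. \<Sum>y\<in>set ys. u i x * g x y * w j y) = 0"
  shows "card I \<le> comm_rank xs ys g"
proof -
  define n where "n = length xs"
  define m where "m = length ys"
  define A where "A = comm_matrix xs ys g"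
  interpret vec_space "TYPE(real)" n .
  have A: "A \<in> carrier_mat n m" by (simp add: A_def comm_matrix_def n_def m_def)
  define W where "W j = vec m (\<lambda>k. w j (ys ! k))" for j
  define v where "v j = A *\<^sub>v W j" for j
  define pair where "pair i z = (\<Sum>k<n. u i (xs ! k) * z $ k)" for i and z :: "real vec"
  have v_carrier: "v j \<in> carrier_vec n" for j
    using A by (auto simp: v_def W_def)
  have v_index: "v j $ k = (\<Sum>y\<in>set ys. g (xs ! k) y * w j y)" if "k < n" for j k
  proof -
    have "v j $ k = (\<Sum>l<m. g (xs ! k) (ys ! l) * w j (ys ! l))"
      using that by (simp add: v_def W_def A_def comm_matrix_def n_def m_def scalar_prod_def
          atLeast0LessThan)
    also have "\<dots> = (\<Sum>y\<in>set ys. g (xs ! k) y * w j y)"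
      using bij_betw_nth[OF dist(2) refl refl] unfolding m_def
      by (rule sum.reindex_bij_betw)
    finally show ?thesis .
  qed
  have pair_v: "pair i (v j) = (\<Sum>x\<in>set xs. \<Sum>y\<in>set ys. u i x * g x y * w j y)" for i j
  proof -
    have "pair i (v j) = (\<Sum>k<n. \<Sum>y\<in>set ys. u i (xs ! k) * g (xs ! k) y * w j y)"
      by (simp add: pair_def v_index sum_distrib_left mult.assoc)
    also have "\<dots> = (\<Sum>x\<in>set xs. \<Sum>y\<in>set ys. u i x * g x y * w j y)"
      using bij_betw_nth[OF dist(1) refl refl] unfolding n_def
      by (rule sum.reindex_bij_betw)
    finally show ?thesis .
  qed
  have inj: "inj_on v I"
    by (rule inj_onI) (metis diag off pair_v)
  have indpt: "lin_indpt (v ` I)"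
  proof (rule finite_lin_indpt2)
    show "finite (v ` I)" using \<open>finite I\<close> by simp
    show "v ` I \<subseteq> carrier_vec n" using v_carrier by auto
    fix a :: "real vec \<Rightarrow> real" assume "lincomb a (v ` I) = 0\<^sub>v n"
    then have zero: "(\<Sum>z\<in>v ` I. a z * z $ k) = 0" if "k < n" for k
      using lincomb_index[OF that, of "v ` I" a] v_carrier that by (simp add: image_subset_iff)
    have "a (v i) = 0" if i: "i \<in> I" for i
    proof -
      have "0 = (\<Sum>k<n. u i (xs ! k) * (\<Sum>z\<in>v ` I. a z * z $ k))"
        by (simp add: zero)
      also have "\<dots> = (\<Sum>j\<in>I. a (v j) * pair i (v j))"
        by (simp add: sum.reindex[OF inj] sum_distrib_left pair_def mult.left_commute
            sum.swap[of _ I])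
      also have "\<dots> = (\<Sum>j\<in>I. if j = i then a (v i) * pair i (v i) else 0)"
        using off i by (intro sum.cong) (auto simp: pair_v)
      also have "\<dots> = a (v i) * pair i (v i)"
        using i \<open>finite I\<close> by simp
      finally show ?thesis using diag[OF i] by (simp add: pair_v)
    qed
    then show "\<forall>z\<in>v ` I. a z = 0" by blast
  qed
  let ?C = "set (cols A)"
  have C: "?C \<subseteq> carrier_vec n" using A cols_dim[of A] by auto
  have sub: "v ` I \<subseteq> span ?C"
  proof -
    have "v j \<in> col_space A" for j
      unfolding col_space_eq[OF A] using A v_carrier by (auto simp: v_def W_def)
    then show ?thesis by (auto simp: col_space_def)
  qed
  interpret S: vectorspace class_ring "span_vs ?C"
    using span_is_subspace[OF C] by (rule subspace_is_vs)
  have "S.lin_indpt (v ` I)"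
    using span_li_not_depend(2)[OF sub span_is_submodule[OF C]] indpt by simp
  then have "card (v ` I) \<le> S.dim"
    using S.li_le_dim(2)[OF fin_dim_span_cols[OF A]] sub by simp
  then show ?thesis
    unfolding comm_rank_def n_def[symmetric] A_def[symmetric] rank_def card_image[OF inj] .
qed

section \<open>Moebius inversion on the subset lattice\<close>

lemma sum_Pow_neg_one: "finite A \<Longrightarrow> (\<Sum>T\<in>Pow A. (-1) ^ card T) = (of_bool (A = {}) :: real)"
  using prod_add[of A "\<lambda>_. -1" "\<lambda>_. 1 :: real"] by (cases "A = {}") (auto simp: power_0_left)

text \<open>Inclusion-exclusion: the alternating sum over subsets of \<open>Z \<inter> S\<close> is
  1 if \<open>S\<close> avoids \<open>Z\<close> and 0 otherwise. This is the change to negated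
  variables: a value is expressed through the zeros of the point, with signed superset sums as
  coefficients.\<close>

lemma sum_Pow_complement:
  fixes \<alpha> :: "'a set \<Rightarrow> real"
  assumes "finite U" "Z \<subseteq> U"
  shows "sum \<alpha> (Pow (U - Z)) = (\<Sum>T\<in>Pow Z. (-1) ^ card T * sum \<alpha> {S. T \<subseteq> S \<and> S \<subseteq> U})"
proof -
  have finZ: "finite Z" using assms finite_subset by blast
  have "(\<Sum>T\<in>Pow Z. (-1) ^ card T * sum \<alpha> {S. T \<subseteq> S \<and> S \<subseteq> U})
      = (\<Sum>T\<in>Pow Z. \<Sum>S | S \<in> Pow U \<and> T \<subseteq> S. (-1) ^ card T * \<alpha> S)"
    unfolding sum_distrib_left by (intro sum.cong refl) auto
  also have "\<dots> = (\<Sum>S\<in>Pow U. \<Sum>T | T \<in> Pow Z \<and> T \<subseteq> S. (-1) ^ card T * \<alpha> S)"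
    using assms(1) finZ by (intro sum.swap_restrict) auto
  also have "\<dots> = (\<Sum>S\<in>Pow U. of_bool (Z \<inter> S = {}) * \<alpha> S)"
  proof (rule sum.cong[OF refl])
    fix S
    have "{T \<in> Pow Z. T \<subseteq> S} = Pow (Z \<inter> S)" by auto
    then show "(\<Sum>T | T \<in> Pow Z \<and> T \<subseteq> S. (-1) ^ card T * \<alpha> S) = of_bool (Z \<inter> S = {}) * \<alpha> S"
      using sum_Pow_neg_one[of "Z \<inter> S"] finZ by (simp flip: sum_distrib_right)
  qed
  also have "\<dots> = sum \<alpha> (Pow (U - Z))"
    using assms(1) by (intro sum.mono_neutral_cong_right) auto
  finally show ?thesis by simp
qed

text \<open>The inverse of the inclusion matrix \<open>of_bool (R \<subseteq> X)\<close>, with the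
  Moebius function of the subset lattice as entries.\<close>

definition mobius :: "'a set \<Rightarrow> 'a set \<Rightarrow> real" where
  "mobius S X = (if X \<subseteq> S then (-1) ^ (card S - card X) else 0)"

lemma sum_mobius:
  assumes "finite U" "S \<subseteq> U"
  shows "(\<Sum>X\<in>Pow U. mobius S X * of_bool (R \<subseteq> X)) = of_bool (S = R)"
proof -
  have "of_bool (S = R) = (\<Sum>X\<in>Pow S. (-1) ^ (card S - card X) * (of_bool (R \<subseteq> X) :: real))"
    by (rule inclusion_exclusion_mobius)
      (use assms finite_subset in \<open>auto simp: of_bool_def\<close>)
  also have "\<dots> = (\<Sum>X\<in>Pow U. mobius S X * of_bool (R \<subseteq> X))"
    using assms by (intro sum.mono_neutral_cong_left) (auto simp: mobius_def)
  finally show ?thesis by simp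
qed

text \<open>As \<open>R \<subseteq> X \<inter> Y\<close> splits into a condition on \<open>X\<close>
  and one on \<open>Y\<close>, the matrix of subset sums is the inclusion matrix times the diagonal
  matrix of \<open>\<gamma>\<close> times the transposed inclusion matrix. The inverses on both
  sides leave the diagonal.\<close>

lemma mobius_diagonalizes:
  fixes \<gamma> :: "'a set \<Rightarrow> real"
  assumes "finite U" "S \<subseteq> U" "T \<subseteq> U"
  shows "(\<Sum>X\<in>Pow U. \<Sum>Y\<in>Pow U. mobius S X * sum \<gamma> (Pow (X \<inter> Y)) * mobius T Y)
       = (if S = T then \<gamma> S else 0)"
proof -
  have expand: "sum \<gamma> (Pow (X \<inter> Y)) = (\<Sum>R\<in>Pow U. \<gamma> R * of_bool (R \<subseteq> X) * of_bool (R \<subseteq> Y))"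
    if "X \<in> Pow U" for X Y
    using that assms(1) by (intro sum.mono_neutral_cong_left) auto
  have "(\<Sum>X\<in>Pow U. \<Sum>Y\<in>Pow U. mobius S X * sum \<gamma> (Pow (X \<inter> Y)) * mobius T Y)
      = (\<Sum>X\<in>Pow U. \<Sum>Y\<in>Pow U. \<Sum>R\<in>Pow U.
          \<gamma> R * ((mobius S X * of_bool (R \<subseteq> X)) * (mobius T Y * of_bool (R \<subseteq> Y))))"
    by (intro sum.cong refl) (simp only: expand sum_distrib_left sum_distrib_right mult_ac)
  also have "\<dots> = (\<Sum>X\<in>Pow U. \<Sum>R\<in>Pow U. \<Sum>Y\<in>Pow U.
          \<gamma> R * ((mobius S X * of_bool (R \<subseteq> X)) * (mobius T Y * of_bool (R \<subseteq> Y))))"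
    by (intro sum.cong refl sum.swap)
  also have "\<dots> = (\<Sum>R\<in>Pow U. \<Sum>X\<in>Pow U. \<Sum>Y\<in>Pow U.
          \<gamma> R * ((mobius S X * of_bool (R \<subseteq> X)) * (mobius T Y * of_bool (R \<subseteq> Y))))"
    by (rule sum.swap)
  also have "\<dots> = (\<Sum>R\<in>Pow U. \<gamma> R * ((\<Sum>X\<in>Pow U. mobius S X * of_bool (R \<subseteq> X))
      * (\<Sum>Y\<in>Pow U. mobius T Y * of_bool (R \<subseteq> Y))))"
    by (simp only: sum_product) (simp only: sum_distrib_left)
  also have "\<dots> = (\<Sum>R\<in>Pow U. if R = S then (if S = T then \<gamma> S else 0) else 0)"
    unfolding sum_mobius[OF assms(1,2)] sum_mobius[OF assms(1,3)] by (intro sum.cong refl) auto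
  also have "\<dots> = (if S = T then \<gamma> S else 0)" using assms by simp
  finally show ?thesis .
qed

text \<open>Rows outside \<open>X\<^sub>0\<close> get weight 0, so a submatrix bounds the rank;
  later this selects the rows with one value of the output bit. The encodings are left free so that
  AND can use the ones of a point and OR its zeros.\<close>

lemma support_le_comm_rank:
  fixes \<gamma> :: "'a set \<Rightarrow> real"
  assumes "distinct xs" "distinct ys" "finite U" and X\<^sub>0: "X\<^sub>0 \<subseteq> set xs"
    and e: "bij_betw e X\<^sub>0 (Pow U)" and e': "bij_betw e' (set ys) (Pow U)"
    and g: "\<And>x y. x \<in> X\<^sub>0 \<Longrightarrow> y \<in> set ys \<Longrightarrow> g x y = sum \<gamma> (Pow (e x \<inter> e' y))"
  shows "card {S \<in> Pow U. \<gamma> S \<noteq> 0} \<le> comm_rank xs ys g"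
proof (rule comm_rank_ge_card[OF assms(1,2)])
  let ?u = "\<lambda>S x. if x \<in> X\<^sub>0 then mobius S (e x) else 0"
  let ?w = "\<lambda>T y. mobius T (e' y)"
  have pairing: "(\<Sum>x\<in>set xs. \<Sum>y\<in>set ys. ?u S x * g x y * ?w T y) = (if S = T then \<gamma> S else 0)"
    if "S \<subseteq> U" "T \<subseteq> U" for S T
  proof -
    have "(\<Sum>x\<in>set xs. \<Sum>y\<in>set ys. ?u S x * g x y * ?w T y)
        = (\<Sum>x\<in>X\<^sub>0. \<Sum>y\<in>set ys. mobius S (e x) * sum \<gamma> (Pow (e x \<inter> e' y)) * mobius T (e' y))"
      using X\<^sub>0 by (intro sum.mono_neutral_cong_right) (auto simp: g intro!: sum.cong)
    also have "\<dots> = (\<Sum>x\<in>X\<^sub>0. \<Sum>Y\<in>Pow U. mobius S (e x) * sum \<gamma> (Pow (e x \<inter> Y)) * mobius T Y)"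
      by (intro sum.cong refl sum.reindex_bij_betw[OF e'])
    also have "\<dots> = (\<Sum>X\<in>Pow U. \<Sum>Y\<in>Pow U. mobius S X * sum \<gamma> (Pow (X \<inter> Y)) * mobius T Y)"
      by (rule sum.reindex_bij_betw[OF e])
    finally show ?thesis using mobius_diagonalizes[OF assms(3) that] by simp
  qed
  show "finite {S \<in> Pow U. \<gamma> S \<noteq> 0}" using assms(3) by simp
  show "(\<Sum>x\<in>set xs. \<Sum>y\<in>set ys. ?u S x * g x y * ?w S y) \<noteq> 0"
    if "S \<in> {S \<in> Pow U. \<gamma> S \<noteq> 0}" for S
    using that pairing[of S S] by simp
  show "(\<Sum>x\<in>set xs. \<Sum>y\<in>set ys. ?u S x * g x y * ?w T y) = 0"
    if "S \<in> {S \<in> Pow U. \<gamma> S \<noteq> 0}" "T \<in> {S \<in> Pow U. \<gamma> S \<noteq> 0}" "S \<noteq> T" for S T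
    using that pairing[of S T] by simp
qed

section \<open>Bit strings as sets of coordinates\<close>

definition ones :: "bool list \<Rightarrow> nat set" where
  "ones x = {i. i < length x \<and> x ! i}"

lemma ones_subset: "x \<in> set (cube n) \<Longrightarrow> ones x \<subseteq> {..<n}"
  by (auto simp: ones_def set_cube)

lemma bij_betw_ones: "bij_betw ones (set (cube n)) (Pow {..<n})"
proof (rule bij_betw_byWitness[where f' = "\<lambda>S. map (\<lambda>i. i \<in> S) [0..<n]"])
  show "\<forall>x\<in>set (cube n). map (\<lambda>i. i \<in> ones x) [0..<n] = x"
    by (auto simp: set_cube ones_def intro!: nth_equalityI)
  show "\<forall>S\<in>Pow {..<n}. ones (map (\<lambda>i. i \<in> S) [0..<n]) = S"
    by (auto simp: ones_def)
qed (auto simp: set_cube ones_def)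

lemma ones_bit_and: "length x = length y \<Longrightarrow> ones (bit_and x y) = ones x \<inter> ones y"
  by (auto simp: ones_def bit_and_def)

lemma ones_bit_or: "length x = length y \<Longrightarrow> ones (bit_or x y) = ones x \<union> ones y"
  by (auto simp: ones_def bit_or_def)

lemma bit_in_cube:
  assumes "x \<in> set (cube n)" "y \<in> set (cube n)"
  shows "bit_and x y \<in> set (cube n)" "bit_or x y \<in> set (cube n)"
  using assms by (auto simp: set_cube bit_and_def bit_or_def)

lemma distinct_cube: "distinct (cube n)"
  by (simp add: cube_def distinct_n_lists)

lemma multilinear_coeff_rep: "multilinear_rep n f (multilinear_coeff n f)"
  unfolding multilinear_coeff_def using multilinear_rep_ex1 by (rule theI')

lemma multilinear_coeff_support: "multilinear_coeff n f S \<noteq> 0 \<Longrightarrow> S \<subseteq> {..<n}"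
  using multilinear_coeff_rep[of n f] by (auto simp: multilinear_rep_def)

lemma finite_monomial_degrees: "finite {card S | S. multilinear_coeff n f S \<noteq> 0}"
proof (rule finite_subset)
  show "{card S | S. multilinear_coeff n f S \<noteq> 0} \<subseteq> card ` Pow {..<n}"
    using multilinear_coeff_support by blast
qed simp

lemma card_le_cube_degree: "multilinear_coeff n f S \<noteq> 0 \<Longrightarrow> card S \<le> cube_degree n f"
  unfolding cube_degree_def by (intro Max_ge[OF finite_monomial_degrees]) blast

lemma eval_multilinear_coeff:
  assumes "x \<in> set (cube n)"
  shows "f x = sum (multilinear_coeff n f) (Pow (ones x))"
proof -
  let ?\<alpha> = "multilinear_coeff n f"
  have "f x = (\<Sum>S\<in>Pow {..<n}. ?\<alpha> S * (\<Prod>i\<in>S. of_bool (x ! i)))"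
    using multilinear_coeff_rep[of n f] assms by (simp add: multilinear_rep_def)
  also have "\<dots> = sum ?\<alpha> (Pow (ones x))"
  proof (rule sum.mono_neutral_cong_right)
    show "Pow (ones x) \<subseteq> Pow {..<n}" using ones_subset[OF assms] by blast
    show "\<forall>S\<in>Pow {..<n} - Pow (ones x). ?\<alpha> S * (\<Prod>i\<in>S. of_bool (x ! i)) = 0"
    proof
      fix S assume S: "S \<in> Pow {..<n} - Pow (ones x)"
      then have "finite S" using finite_subset by blast
      moreover obtain i where "i \<in> S" "\<not> x ! i"
        using S assms by (auto simp: ones_def set_cube)
      ultimately show "?\<alpha> S * (\<Prod>i\<in>S. of_bool (x ! i)) = 0" by (auto intro: prod_zero)
    qed
    show "?\<alpha> S * (\<Prod>i\<in>S. of_bool (x ! i)) = ?\<alpha> S" if "S \<in> Pow (ones x)" for S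
    proof -
      have "(\<Prod>i\<in>S. of_bool (x ! i)) = (1 :: real)"
        using that by (intro prod.neutral) (auto simp: ones_def)
      then show ?thesis by simp
    qed
  qed simp
  finally show ?thesis .
qed

text \<open>A nonzero value forces a nonzero coefficient, so the maximum is over a nonempty
  set.\<close>

lemma cube_degree_attained:
  assumes "x \<in> set (cube n)" "f x \<noteq> 0"
  shows "\<exists>S. multilinear_coeff n f S \<noteq> 0 \<and> card S = cube_degree n f"
proof -
  let ?D = "{card S | S. multilinear_coeff n f S \<noteq> 0}"
  have "\<exists>S. multilinear_coeff n f S \<noteq> 0"
    using assms eval_multilinear_coeff[OF assms(1), of f] by (metis sum.neutral)
  then have "?D \<noteq> {}" by blast
  with finite_monomial_degrees have "cube_degree n f \<in> ?D"
    unfolding cube_degree_def by (rule Max_in)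
  then show ?thesis by auto
qed

definition monomials :: "nat \<Rightarrow> (bool list \<Rightarrow> real) \<Rightarrow> nat" where
  "monomials n f = card {S \<in> Pow {..<n}. multilinear_coeff n f S \<noteq> 0}"

text \<open>Expanding the monomials \<open>\<Prod>i\<in>S. 1 - z\<^sub>i\<close> shows that these superset sums are, up to sign, the
  coefficients of \<open>f\<close> in the negated variables.\<close>

definition comonomials :: "nat \<Rightarrow> (bool list \<Rightarrow> real) \<Rightarrow> nat" where
  "comonomials n f = card {T \<in> Pow {..<n}. sum (multilinear_coeff n f) {S. T \<subseteq> S \<and> S \<subseteq> {..<n}} \<noteq> 0}"

lemma degree_le_monomials:
  assumes "x \<in> set (cube n)" "f x \<noteq> 0"
  shows "2 ^ cube_degree n f \<le> monomials n f * comonomials n f"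
proof -
  obtain S where "multilinear_coeff n f S \<noteq> 0" "card S = cube_degree n f"
    using cube_degree_attained[of x n f] assms by blast
  moreover from this(1) have "S \<subseteq> {..<n}" by (rule multilinear_coeff_support)
  ultimately show ?thesis
    using support_uncertainty[of "{..<n}" S "multilinear_coeff n f"]
    by (simp add: monomials_def comonomials_def)
qed

lemma monomials_le_comm_rank:
  assumes "distinct xs" "X\<^sub>0 \<subseteq> set xs" "bij_betw p X\<^sub>0 (set (cube n))"
    and g: "\<And>x y. x \<in> X\<^sub>0 \<Longrightarrow> y \<in> set (cube n) \<Longrightarrow> g x y = f (bit_and (p x) y)"
  shows "monomials n f \<le> comm_rank xs (cube n) g"
  unfolding monomials_def
proof (rule support_le_comm_rank[OF assms(1) distinct_cube _ assms(2) _ bij_betw_ones])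
  show "bij_betw (ones \<circ> p) X\<^sub>0 (Pow {..<n})"
    using assms(3) bij_betw_ones by (rule bij_betw_trans)
  fix x y assume x: "x \<in> X\<^sub>0" and y: "y \<in> set (cube n)"
  then have px: "p x \<in> set (cube n)" using assms(3) bij_betwE by blast
  then have "ones (bit_and (p x) y) = ones (p x) \<inter> ones y"
    using y by (intro ones_bit_and) (simp add: set_cube)
  then show "g x y = sum (multilinear_coeff n f) (Pow ((ones \<circ> p) x \<inter> ones y))"
    using eval_multilinear_coeff[OF bit_in_cube(1)[OF px y], of f] g[OF x y] by simp
qed simp

text \<open>De Morgan: the zeros of a bitwise OR are the common zeros, so in negated variables OR is
  again an intersection, now with the coefficients \<open>\<gamma>\<close>.\<close>

lemma comonomials_le_comm_rank:
  assumes "distinct xs" "X\<^sub>0 \<subseteq> set xs" "bij_betw p X\<^sub>0 (set (cube n))"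
    and g: "\<And>x y. x \<in> X\<^sub>0 \<Longrightarrow> y \<in> set (cube n) \<Longrightarrow> g x y = f (bit_or (p x) y)"
  shows "comonomials n f \<le> comm_rank xs (cube n) g"
proof -
  let ?\<alpha> = "multilinear_coeff n f" and ?U = "{..<n}"
  define \<gamma> where "\<gamma> T = (-1) ^ card T * sum ?\<alpha> {S. T \<subseteq> S \<and> S \<subseteq> ?U}" for T
  have compl: "bij_betw ((-) ?U) (Pow ?U) (Pow ?U)"
    by (rule bij_betw_byWitness[where f' = "(-) ?U"]) auto
  have "card {S \<in> Pow ?U. \<gamma> S \<noteq> 0} \<le> comm_rank xs (cube n) g"
  proof (rule support_le_comm_rank[OF assms(1) distinct_cube _ assms(2)])
    show "bij_betw ((-) ?U \<circ> (ones \<circ> p)) X\<^sub>0 (Pow ?U)"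
      using assms(3) bij_betw_ones compl by (intro bij_betw_trans)
    show "bij_betw ((-) ?U \<circ> ones) (set (cube n)) (Pow ?U)"
      using bij_betw_ones compl by (rule bij_betw_trans)
    fix x y assume x: "x \<in> X\<^sub>0" and y: "y \<in> set (cube n)"
    then have px: "p x \<in> set (cube n)" using assms(3) bij_betwE by blast
    let ?Z = "(?U - ones (p x)) \<inter> (?U - ones y)"
    have "ones (bit_or (p x) y) = ones (p x) \<union> ones y"
      using px y by (intro ones_bit_or) (simp add: set_cube)
    also have "\<dots> = ?U - ?Z"
      using ones_subset[OF px] ones_subset[OF y] by blast
    finally have "g x y = sum ?\<alpha> (Pow (?U - ?Z))"
      using eval_multilinear_coeff[OF bit_in_cube(2)[OF px y], of f] g[OF x y] by simp
    also have "\<dots> = sum \<gamma> (Pow ?Z)"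
      unfolding \<gamma>_def by (rule sum_Pow_complement) auto
    finally show "g x y = sum \<gamma> (Pow (((-) ?U \<circ> (ones \<circ> p)) x \<inter> ((-) ?U \<circ> ones) y))"
      by simp
  qed simp
  then show ?thesis by (simp add: \<gamma>_def comonomials_def)
qed

section \<open>Block sensitivity\<close>

lemma prod_dist:
  fixes i d :: nat
  assumes "1 \<le> i" "i \<le> d"
  shows "(\<Prod>k\<in>{1..d} - {i}. \<bar>real k - real i\<bar>) = fact (i - 1) * fact (d - i)"
  using assms(2)
proof (induction d rule: dec_induct)
  case base
  have "(\<Prod>k\<in>{1..i} - {i}. \<bar>real k - real i\<bar>) = (\<Prod>k\<in>{1..i-1}. real k)"
    by (rule prod.reindex_bij_witness[of _ "\<lambda>k. i - k" "\<lambda>k. i - k"]) (use assms in auto)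
  also have "\<dots> = fact (i - 1)" by (simp add: fact_prod)
  finally show ?case by simp
next
  case (step d)
  have "{1..Suc d} - {i} = insert (Suc d) ({1..d} - {i})" using step by auto
  then show ?case using step by (simp add: Suc_diff_le algebra_simps)
qed

lemma prod_shift: "(\<Prod>k\<in>{1..d}. real k + real i) * fact i = fact (d + i)"
proof (induction d)
  case (Suc d)
  have "(\<Prod>k\<in>{1..Suc d}. real k + real i) * fact i
      = (real (Suc d) + real i) * ((\<Prod>k\<in>{1..d}. real k + real i) * fact i)"
    by simp
  also have "\<dots> = fact (Suc d + i)" unfolding Suc by simp
  finally show ?case .
qed simp

text \<open>Passing from \<open>i\<close> to \<open>Suc i\<close> multiplies the right-hand side by
  \<open>(d + i + 1) / (d - i)\<close>, which is at least 1.\<close>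

lemma fact_square_le: "i \<le> d \<Longrightarrow> fact d * fact d \<le> (fact (d - i) * fact (d + i) :: real)"
proof (induction i)
  case (Suc i)
  have "(fact d * fact d :: real) \<le> fact (d - i) * fact (d + i)" using Suc by simp
  also have "\<dots> = real (d - i) * (fact (d - Suc i) * fact (d + i))"
    using Suc.prems by (simp add: fact_reduce[of "d - i"])
  also have "\<dots> \<le> real (Suc (d + i)) * (fact (d - Suc i) * fact (d + i))"
    by (intro mult_right_mono) auto
  also have "\<dots> = fact (d - Suc i) * fact (d + Suc i)" by (simp add: mult_ac)
  finally show ?case .
qed auto

text \<open>These are the absolute values at 0 of the Lagrange basis polynomials for the nodes
  \<open>1, 4, 9\<close> up to \<open>d^2\<close>. Factoring \<open>k^2 - i^2\<close> gives exactly
  twice the quotient of \<open>fact d * fact d\<close> by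
  \<open>fact (d - i) * fact (d + i)\<close>.\<close>

lemma lagrange_weight_squares:
  assumes "1 \<le> i" "i \<le> d"
  shows "(\<Prod>k\<in>{1..d} - {i}. (real k)\<^sup>2 / \<bar>(real k)\<^sup>2 - (real i)\<^sup>2\<bar>) \<le> 2"
proof -
  have i: "i \<in> {1..d}" using assms by simp
  have "(\<Prod>k\<in>{1..d}. real k) = real i * (\<Prod>k\<in>{1..d} - {i}. real k)"
    using prod.remove[OF _ i] by blast
  then have num: "fact d = real i * (\<Prod>k\<in>{1..d} - {i}. real k)"
    by (simp add: fact_prod)
  have plus: "fact (d + i) = fact i * (2 * real i * (\<Prod>k\<in>{1..d} - {i}. real k + real i))"
    using prod_shift[of i d] prod.remove[OF _ i, of "\<lambda>k. real k + real i"] by (simp add: mult.commute)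
  have fi: "fact i = real i * fact (i - 1)" using assms by (simp add: fact_reduce)
  have "(\<Prod>k\<in>{1..d} - {i}. (real k)\<^sup>2 / \<bar>(real k)\<^sup>2 - (real i)\<^sup>2\<bar>)
      = (\<Prod>k\<in>{1..d} - {i}. real k)\<^sup>2 /
         ((\<Prod>k\<in>{1..d} - {i}. \<bar>real k - real i\<bar>) * (\<Prod>k\<in>{1..d} - {i}. real k + real i))"
    unfolding prod_dividef prod_power_distrib prod.distrib[symmetric]
    by (intro arg_cong2[of _ _ _ _ "(/)"] prod.cong refl)
      (simp add: power2_eq_square square_diff_square_factored abs_mult)
  also have "\<dots> = 2 * (fact d * fact d / (fact (d - i) * fact (d + i)))"
    unfolding prod_dist[OF assms] num plus fi using assms
    by (simp add: divide_simps power2_eq_square)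
  also have "\<dots> \<le> 2 * 1"
    using fact_square_le[OF assms(2)] by (intro mult_left_mono) (simp_all add: divide_le_eq_1)
  also have "\<dots> = 2" by simp
  finally show ?thesis .
qed

lemma sum_inverse_squares_le: "(\<Sum>i=1..d. 1 / (real i)\<^sup>2) \<le> 2"
proof -
  \<comment> \<open>The subtracted \<open>1 / real d\<close> lets the induction telescope.\<close>
  have "(\<Sum>i=1..d. 1 / (real i)\<^sup>2) \<le> 2 - 1 / real d" if "d \<ge> 1"
    using that
  proof (induction d rule: dec_induct)
    case (step d)
    have "1 / (real (Suc d))\<^sup>2 \<le> 1 / (real d * real (Suc d))"
      using step by (intro divide_left_mono) (auto simp: power2_eq_square)
    also have "\<dots> = 1 / real d - 1 / real (Suc d)" using step by (simp add: field_simps)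
    finally show ?case using step by simp
  qed simp
  moreover have "2 - 1 / real d \<le> 2" by simp
  ultimately show ?thesis by (cases "d \<ge> 1") (blast intro: order.trans, simp)
qed

text \<open>Interpolating \<open>x ^ s\<close> at more than \<open>s\<close> distinct nodes is
  exact; evaluation at 0 gives the identity, with value 1 for \<open>s = 0\<close>.\<close>

lemma lagrange_at_0:
  fixes t :: "'a \<Rightarrow> real"
  assumes "finite N" "inj_on t N" "s < card N"
  shows "(\<Sum>i\<in>N. t i ^ s * (\<Prod>k\<in>N - {i}. t k / (t k - t i))) = 0 ^ s"
proof -
  define L where "L i = (\<Prod>k\<in>N - {i}. Polynomial.smult (1 / (t k - t i)) [:t k, -1:])" for i
  define P where "P = (\<Sum>i\<in>N. Polynomial.smult (t i ^ s) (L i))"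
  have poly_L: "poly (L i) x = (\<Prod>k\<in>N - {i}. (t k - x) / (t k - t i))" for i x
    by (simp add: L_def poly_prod diff_divide_distrib)
  have deg_L: "degree (L i) < card N" if "i \<in> N" for i
  proof -
    have "degree (L i) \<le> (\<Sum>k\<in>N - {i}. degree (Polynomial.smult (1 / (t k - t i)) [:t k, -1:]))"
      unfolding L_def using assms by (intro degree_prod_sum_le[unfolded o_def]) simp
    also have "\<dots> \<le> (\<Sum>k\<in>N - {i}. 1)" by (intro sum_mono) auto
    also have "\<dots> < card N" using assms that by (simp add: card_Diff_singleton)
    finally show ?thesis .
  qed
  have "P = Polynomial.monom 1 s"
  proof (rule poly_eqI_degree[of "t ` N"])
    fix x assume "x \<in> t ` N"
    then obtain j where j: "j \<in> N" "x = t j" by auto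
    have "poly (L i) (t j) = of_bool (i = j)" if "i \<in> N" for i
    proof (cases "i = j")
      case True
      then show ?thesis using assms(2) that
        unfolding poly_L by (auto intro!: prod.neutral simp: inj_on_eq_iff)
    next
      case False
      then show ?thesis using assms(1) j unfolding poly_L by auto
    qed
    then have "poly P x = (\<Sum>i\<in>N. t i ^ s * of_bool (i = j))"
      by (simp add: P_def poly_sum j)
    also have "\<dots> = t j ^ s" using j assms(1) by simp
    finally show "poly P x = poly (Polynomial.monom 1 s) x" by (simp add: poly_monom j)
  next
    show "degree P < card (t ` N)" 
      unfolding P_def card_image[OF assms(2)]
      by (rule degree_sum_less) (use assms(3) deg_L le_less_trans[OF degree_smult_le] in auto)
    show "degree (Polynomial.monom (1::real) s) < card (t ` N)"
      using assms by (simp add: card_image degree_monom_eq)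
  qed
  then have "poly P 0 = 0 ^ s" by (simp add: poly_monom)
  then show ?thesis by (simp add: P_def poly_sum poly_L)
qed

section \<open>Biased random points and sensitivity\<close>

lemma sum_weights_supersets:
  fixes t :: real
  assumes "finite J" "W \<subseteq> J"
  shows "(\<Sum>Y | W \<subseteq> Y \<and> Y \<subseteq> J. t ^ card Y * (1 - t) ^ card (J - Y)) = t ^ card W"
proof -
  have fin: "finite W" using assms finite_subset by blast
  have "(\<Sum>Y | W \<subseteq> Y \<and> Y \<subseteq> J. t ^ card Y * (1 - t) ^ card (J - Y))
      = (\<Sum>X\<in>Pow (J - W). t ^ card W * (t ^ card X * (1 - t) ^ card (J - W - X)))"
  proof (rule sum.reindex_bij_witness[of _ "\<lambda>X. W \<union> X" "\<lambda>Y. Y - W"])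
    fix Y assume Y: "Y \<in> {Y. W \<subseteq> Y \<and> Y \<subseteq> J}"
    then have "finite Y" using assms finite_subset by blast
    with Y fin have "card Y = card W + card (Y - W)" by (simp add: card_Diff_subset card_mono)
    moreover have "J - W - (Y - W) = J - Y" using Y by auto
    ultimately show "t ^ card W * (t ^ card (Y - W) * (1 - t) ^ card (J - W - (Y - W)))
        = t ^ card Y * (1 - t) ^ card (J - Y)"
      by (simp add: power_add)
  qed (use assms in auto)
  also have "\<dots> = t ^ card W * (\<Prod>x\<in>J - W. t + (1 - t))"
    using assms by (subst prod_add) (auto simp: sum_distrib_left)
  finally show ?thesis by simp
qed

text \<open>The sum is the expected value at a random subset of \<open>J\<close> containing each
  element independently with probability \<open>t\<close>, since such a subset contains
  \<open>W\<close> with probability \<open>t ^ card W\<close>. An average of values in [-1, 1] stays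
  there.\<close>

lemma multilinear_bound:
  fixes c :: "'a set \<Rightarrow> real"
  assumes "finite J" and bound: "\<And>Y. Y \<subseteq> J \<Longrightarrow> \<bar>sum c (Pow Y)\<bar> \<le> 1" and t: "0 \<le> t" "t \<le> 1"
  shows "\<bar>\<Sum>W\<in>Pow J. c W * t ^ card W\<bar> \<le> 1"
proof -
  let ?w = "\<lambda>Y. t ^ card Y * (1 - t) ^ card (J - Y)"
  have "(\<Sum>W\<in>Pow J. c W * t ^ card W)
      = (\<Sum>W\<in>Pow J. \<Sum>Y | Y \<in> Pow J \<and> W \<in> Pow Y. c W * ?w Y)"
  proof (rule sum.cong[OF refl])
    fix W assume "W \<in> Pow J"
    moreover have "{Y \<in> Pow J. W \<in> Pow Y} = {Y. W \<subseteq> Y \<and> Y \<subseteq> J}" by auto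
    ultimately show "c W * t ^ card W = (\<Sum>Y | Y \<in> Pow J \<and> W \<in> Pow Y. c W * ?w Y)"
      using sum_weights_supersets[OF assms(1), of W t] by (simp flip: sum_distrib_left)
  qed
  also have "\<dots> = (\<Sum>Y\<in>Pow J. \<Sum>W | W \<in> Pow J \<and> W \<in> Pow Y. c W * ?w Y)"
    using assms(1) by (intro sum.swap_restrict) auto
  also have "\<dots> = (\<Sum>Y\<in>Pow J. sum c (Pow Y) * ?w Y)"
  proof (rule sum.cong[OF refl])
    fix Y assume "Y \<in> Pow J"
    then have "{W \<in> Pow J. W \<in> Pow Y} = Pow Y" by auto
    then show "(\<Sum>W | W \<in> Pow J \<and> W \<in> Pow Y. c W * ?w Y) = sum c (Pow Y) * ?w Y"
      by (simp flip: sum_distrib_right)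
  qed
  also have "\<bar>\<dots>\<bar> \<le> (\<Sum>Y\<in>Pow J. 1 * ?w Y)"
  proof (rule order.trans[OF sum_abs], rule sum_mono)
    fix Y assume "Y \<in> Pow J"
    then have "\<bar>sum c (Pow Y)\<bar> \<le> 1" using bound by simp
    moreover have "?w Y \<ge> 0" using t by simp
    ultimately show "\<bar>sum c (Pow Y) * ?w Y\<bar> \<le> 1 * ?w Y"
      by (metis abs_mult abs_of_nonneg mult_right_mono)
  qed
  also have "\<dots> = 1"
    using sum_weights_supersets[OF assms(1), of "{}" t] by (simp add: Pow_def)
  finally show ?thesis .
qed

lemma sensitivity_le:
  fixes c :: "'a set \<Rightarrow> real"
  assumes "finite J" and deg: "\<And>W. W \<subseteq> J \<Longrightarrow> c W \<noteq> 0 \<Longrightarrow> card W \<le> d"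
    and sign: "\<And>Y. Y \<subseteq> J \<Longrightarrow> sum c (Pow Y) \<in> {-1, 1}"
    and sens: "\<And>j. j \<in> J \<Longrightarrow> c {j} \<noteq> 0"
  shows "card J \<le> 4 * d ^ 2"
proof (cases "J = {}")
  case False
  then obtain j\<^sub>0 where "j\<^sub>0 \<in> J" by blast
  then have d: "d \<ge> 1" using deg[of "{j\<^sub>0}"] sens by auto
  txt \<open>The expected value \<open>q t\<close> of the function at a random point with independent coordinates of bias
    \<open>t\<close> is a polynomial of degree at most \<open>d\<close> bounded by 1 on \<open>[0, 1]\<close>, with
    \<open>\<bar>q' 0\<bar> = 2 card J\<close>. We interpolate \<open>r t = (q t - q 0) / t\<close> at the nodes \<open>(i / d)\<^sup>2\<close>, which
    mimic Chebyshev nodes near 0, to bound \<open>r 0 = q' 0\<close>.\<close>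
  define r where "r t = (\<Sum>W\<in>Pow J - {{}}. c W * t ^ (card W - 1))" for t
  have c0: "c {} = 1 \<or> c {} = -1" using sign[of "{}"] by auto
  have sign_bound: "\<bar>sum c (Pow Y)\<bar> \<le> 1" if "Y \<subseteq> J" for Y
    using sign[OF that] by auto
  \<comment> \<open>Both \<open>c {}\<close> and \<open>c {} + c {j}\<close> are signs, and they
    differ.\<close>
  have c1: "c {j} = -2 * c {}" if "j \<in> J" for j
  proof -
    have "sum c (Pow {j}) = c {} + c {j}" by (simp add: Pow_insert)
    then show ?thesis using sign[of "{j}"] sens[OF that] c0 that by auto
  qed
  have r_bound: "\<bar>r t\<bar> \<le> 2 / t" if t: "0 < t" "t \<le> 1" for t
  proof -
    have "t * r t = (\<Sum>W\<in>Pow J - {{}}. c W * t ^ card W)"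
      unfolding r_def sum_distrib_left
    proof (rule sum.cong[OF refl])
      fix W assume "W \<in> Pow J - {{}}"
      then have "card W > 0" using assms(1) finite_subset by (auto simp: card_gt_0_iff)
      then have "t * t ^ (card W - 1) = t ^ card W" by (metis power_Suc Suc_pred')
      then show "t * (c W * t ^ (card W - 1)) = c W * t ^ card W" by (metis mult.left_commute)
    qed
    also have "\<dots> = (\<Sum>W\<in>Pow J. c W * t ^ card W) - c {}"
      using assms(1) by (subst sum_diff1) auto
    finally have "\<bar>t * r t\<bar> \<le> 2"
      using multilinear_bound[OF assms(1) sign_bound less_imp_le[OF t(1)] t(2)] c0 by linarith
    then show ?thesis using t by (simp add: abs_mult field_simps)
  qed
  \<comment> \<open>With \<open>0 ^ 0 = 1\<close> only the singletons survive; their common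
    coefficient rules out cancellation.\<close>
  have "r 0 = (\<Sum>W\<in>(\<lambda>j. {j}) ` J. c W * 0 ^ (card W - 1))"
    unfolding r_def
  proof (rule sum.mono_neutral_right)
    show "\<forall>W\<in>Pow J - {{}} - (\<lambda>j. {j}) ` J. c W * 0 ^ (card W - 1) = 0"
    proof
      fix W assume W: "W \<in> Pow J - {{}} - (\<lambda>j. {j}) ` J"
      then have "finite W" using assms(1) finite_subset by blast
      moreover have "card W \<noteq> 1" using W by (auto simp: card_1_singleton_iff)
      moreover have "card W \<noteq> 0" using W \<open>finite W\<close> by auto
      ultimately have "card W - 1 \<noteq> 0" by linarith
      then show "c W * 0 ^ (card W - 1) = 0" by simp
    qed
  qed (use assms(1) in auto)
  also have "\<dots> = (\<Sum>j\<in>J. -2 * c {})"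
    by (subst sum.reindex) (auto simp: c1 intro!: sum.cong)
  finally have r0: "\<bar>r 0\<bar> = 2 * card J" using c0 by (auto simp: abs_mult)
  define t where "t i = (real i / real d)\<^sup>2" for i
  define w where "w i = (\<Prod>k\<in>{1..d} - {i}. t k / (t k - t i))" for i
  have inj: "inj_on t {1..d}"
    using d by (intro inj_onI) (simp add: t_def power2_eq_iff_nonneg)
  have w: "\<bar>w i\<bar> \<le> 2" if "i \<in> {1..d}" for i
  proof -
    have "\<bar>w i\<bar> = (\<Prod>k\<in>{1..d} - {i}. (real k)\<^sup>2 / \<bar>(real k)\<^sup>2 - (real i)\<^sup>2\<bar>)"
      unfolding w_def abs_prod
    proof (rule prod.cong[OF refl])
      fix k
      have "t k - t i = ((real k)\<^sup>2 - (real i)\<^sup>2) / (real d)\<^sup>2"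
        by (simp add: t_def power_divide diff_divide_distrib)
      then show "\<bar>t k / (t k - t i)\<bar> = (real k)\<^sup>2 / \<bar>(real k)\<^sup>2 - (real i)\<^sup>2\<bar>"
        using d by (simp add: t_def power_divide abs_divide)
    qed
    then show ?thesis using lagrange_weight_squares[of i d] that by simp
  qed
  \<comment> \<open>Occurring exponents are at most \<open>d - 1\<close>, so \<open>d\<close> nodes
    reproduce each power.\<close>
  have "r 0 = (\<Sum>W\<in>Pow J - {{}}. \<Sum>i\<in>{1..d}. w i * (c W * t i ^ (card W - 1)))"
    unfolding r_def
  proof (rule sum.cong[OF refl])
    fix W assume W: "W \<in> Pow J - {{}}"
    show "c W * 0 ^ (card W - 1) = (\<Sum>i\<in>{1..d}. w i * (c W * t i ^ (card W - 1)))"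
    proof (cases "c W = 0")
      case False
      then have "card W - 1 < card {1..d}" using deg[of W] W d by auto
      have "(\<Sum>i\<in>{1..d}. w i * (c W * t i ^ (card W - 1)))
          = c W * (\<Sum>i\<in>{1..d}. t i ^ (card W - 1) * w i)"
        unfolding sum_distrib_left by (intro sum.cong refl) (simp only: mult_ac)
      also have "\<dots> = c W * 0 ^ (card W - 1)"
        unfolding w_def using lagrange_at_0[OF _ inj \<open>card W - 1 < card {1..d}\<close>] by simp
      finally show ?thesis ..
    qed simp
  qed
  also have "\<dots> = (\<Sum>i\<in>{1..d}. w i * r (t i))"
    unfolding r_def sum_distrib_left by (rule sum.swap)
  \<comment> \<open>Each term is a weight of at most 2 times \<open>2 / t i = 2 * d^2 / i^2\<close>.
    The inverse squares sum to at most 2, so the total \<open>8 * d^2\<close> bounds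
    \<open>2 * card J\<close>.\<close>
  also have "\<bar>\<dots>\<bar> \<le> (\<Sum>i\<in>{1..d}. 4 * (real d)\<^sup>2 * (1 / (real i)\<^sup>2))"
  proof (rule order.trans[OF sum_abs], rule sum_mono)
    fix i assume i: "i \<in> {1..d}"
    then have "0 < t i" "t i \<le> 1" using d by (auto simp: t_def power_le_one)
    then have "\<bar>w i\<bar> * \<bar>r (t i)\<bar> \<le> 2 * (2 / t i)"
      using w[OF i] r_bound[of "t i"] by (intro mult_mono) auto
    then show "\<bar>w i * r (t i)\<bar> \<le> 4 * (real d)\<^sup>2 * (1 / (real i)\<^sup>2)"
      by (simp add: abs_mult t_def power_divide)
  qed
  also have "\<dots> \<le> 4 * (real d)\<^sup>2 * 2"
    unfolding sum_distrib_left[symmetric]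
    using sum_inverse_squares_le[of d] by (intro mult_left_mono) auto
  finally have "real (card J) \<le> real (4 * d ^ 2)" using r0 by simp
  then show ?thesis by linarith
qed simp

text \<open>The variables of \<open>V\<close> with label \<open>j\<close> are merged into one new
  variable and those outside \<open>V\<close> are set to 0. Then \<open>c W\<close> collects the
  monomials with label set \<open>W\<close>; images do not grow, so the degree bound persists, and
  sensitive blocks become sensitive coordinates. Labels encode disjointness of the blocks.\<close>

lemma block_sensitivity_le:
  fixes \<alpha> :: "'a set \<Rightarrow> real" and l :: "'a \<Rightarrow> 'b"
  assumes "finite U" and deg: "\<And>S. S \<subseteq> U \<Longrightarrow> \<alpha> S \<noteq> 0 \<Longrightarrow> card S \<le> d"
    and sign: "\<And>X. X \<subseteq> U \<Longrightarrow> sum \<alpha> (Pow X) \<in> {-1, 1}"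
    and V: "V \<subseteq> U" and J: "finite J" "l ` V \<subseteq> J"
    and sens: "\<And>j. j \<in> J \<Longrightarrow> sum \<alpha> (Pow {x \<in> V. l x = j}) \<noteq> \<alpha> {}"
  shows "card J \<le> 4 * d ^ 2"
proof -
  have finV: "finite V" using assms(1) V finite_subset by blast
  define c where "c W = sum \<alpha> {S \<in> Pow V. l ` S = W}" for W
  have sum_c: "sum c (Pow Y) = sum \<alpha> (Pow {x \<in> V. l x \<in> Y})" if Y: "Y \<subseteq> J" for Y
  proof -
    have "sum c (Pow Y) = (\<Sum>W\<in>Pow Y. sum \<alpha> {S \<in> Pow {x \<in> V. l x \<in> Y}. l ` S = W})"
      unfolding c_def by (intro sum.cong refl) blast
    also have "\<dots> = sum \<alpha> (Pow {x \<in> V. l x \<in> Y})"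
      using finV J(1) Y finite_subset by (intro sum.group) auto
    finally show ?thesis .
  qed
  show ?thesis
  proof (rule sensitivity_le[OF J(1), of c])
    fix W assume "W \<subseteq> J" "c W \<noteq> 0"
    then obtain S where S: "S \<subseteq> V" "l ` S = W" "\<alpha> S \<noteq> 0"
      unfolding c_def by (auto elim: sum.not_neutral_contains_not_neutral)
    then have "card W \<le> card S" using finV finite_subset card_image_le by blast
    also have "\<dots> \<le> d" using deg S V by blast
    finally show "card W \<le> d" .
  next
    fix Y assume Y: "Y \<subseteq> J"
    have "{x \<in> V. l x \<in> Y} \<subseteq> U" using V by auto
    then show "sum c (Pow Y) \<in> {-1, 1}" using sum_c[OF Y] sign by simp
  next
    fix j assume j: "j \<in> J"
    have "c {} = \<alpha> {}" using sum_c[of "{}"] by simp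
    moreover have "c {} + c {j} = sum c (Pow {j})" by (simp add: Pow_insert)
    ultimately show "c {j} \<noteq> 0" using sum_c[of "{j}"] j sens[OF j] by auto
  qed
qed

text \<open>For a minimal nonempty \<open>B \<subseteq> S\<close> with nonzero coefficient, the
  subset sum reduces to \<open>\<alpha> {} + \<alpha> B\<close>.\<close>

lemma sensitive_block_exists:
  fixes \<alpha> :: "'a set \<Rightarrow> real"
  assumes "finite S" "S \<noteq> {}" "\<alpha> S \<noteq> 0"
  shows "\<exists>B\<subseteq>S. sum \<alpha> (Pow B) \<noteq> \<alpha> {}"
proof -
  let ?\<B> = "{B \<in> Pow S. B \<noteq> {} \<and> \<alpha> B \<noteq> 0}"
  have "finite ?\<B>" "?\<B> \<noteq> {}" using assms by auto
  then obtain B where B: "B \<in> ?\<B>" "\<forall>C\<in>?\<B>. C \<subseteq> B \<longrightarrow> B = C"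
    by (meson finite_has_minimal)
  have "finite B" using B(1) assms(1) finite_subset by blast
  have "sum \<alpha> (Pow B) = sum \<alpha> {{}, B}"
    using B \<open>finite B\<close> by (intro sum.mono_neutral_right) auto
  also have "\<dots> = \<alpha> {} + \<alpha> B" using B(1) by (subst sum.insert) auto
  finally have "sum \<alpha> (Pow B) \<noteq> \<alpha> {}" using B(1) by simp
  then show ?thesis using B(1) by blast
qed

lemma sum_Pow_Un:
  fixes \<alpha> :: "'a set \<Rightarrow> real"
  assumes "A \<inter> B = {}"
  shows "sum \<alpha> (Pow (A \<union> B)) = (\<Sum>S\<in>Pow A. \<Sum>R\<in>Pow B. \<alpha> (S \<union> R))"
  unfolding sum.cartesian_product
proof (rule sum.reindex_bij_witness[of _ "\<lambda>(S, R). S \<union> R" "\<lambda>T. (T \<inter> A, T \<inter> B)"])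
  fix T assume "T \<in> Pow (A \<union> B)"
  then have "T \<inter> A \<union> T \<inter> B = T" by blast
  then show "(case (T \<inter> A, T \<inter> B) of (S, R) \<Rightarrow> S \<union> R) = T"
    "(case (T \<inter> A, T \<inter> B) of (S, R) \<Rightarrow> \<alpha> (S \<union> R)) = \<alpha> T"
    by simp_all
next
  fix P assume "P \<in> Pow A \<times> Pow B"
  then obtain S R where P: "P = (S, R)" "S \<subseteq> A" "R \<subseteq> B" by blast
  then have "(S \<union> R) \<inter> A = S" "(S \<union> R) \<inter> B = R" using assms by blast+
  then show "((case P of (S, R) \<Rightarrow> S \<union> R) \<inter> A, (case P of (S, R) \<Rightarrow> S \<union> R) \<inter> B) = P"
    by (simp add: P)
qed auto

section \<open>Decision trees and protocols\<close>

datatype ('v, 'o) dtree = Leaf 'o | Query 'v "('v, 'o) dtree" "('v, 'o) dtree"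

primrec dt_eval :: "('v, 'o) dtree \<Rightarrow> 'v set \<Rightarrow> 'o" where
  "dt_eval (Leaf z) X = z"
| "dt_eval (Query i s t) X = (if i \<in> X then dt_eval t X else dt_eval s X)"

primrec dt_depth :: "('v, 'o) dtree \<Rightarrow> nat" where
  "dt_depth (Leaf z) = 0"
| "dt_depth (Query i s t) = Suc (max (dt_depth s) (dt_depth t))"

text \<open>The variables of \<open>Q\<close> are queried one by one before the tree for the
  observed answers is entered. The arbitrary \<open>D\<close> lets the induction narrow to inputs
  consistent with the answer to \<open>q\<close>.\<close>

lemma dtree_query_all:
  assumes "finite Q"
    and "\<And>Z. Z \<subseteq> Q \<Longrightarrow> \<exists>t. dt_depth t \<le> k \<and> (\<forall>X\<in>D. X \<inter> Q = Z \<longrightarrow> dt_eval t X = g X)"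
  shows "\<exists>t. dt_depth t \<le> k + card Q \<and> (\<forall>X\<in>D. dt_eval t X = g X)"
  using assms
proof (induction Q arbitrary: D rule: finite_induct)
  case (insert q Q)
  have "\<exists>t. dt_depth t \<le> k + card Q \<and> (\<forall>X\<in>{X \<in> D. q \<notin> X}. dt_eval t X = g X)"
  proof (rule insert.IH)
    fix Z assume "Z \<subseteq> Q"
    then obtain t where "dt_depth t \<le> k" "\<forall>X\<in>D. X \<inter> insert q Q = Z \<longrightarrow> dt_eval t X = g X"
      using insert.prems[of Z] by blast
    then show "\<exists>t. dt_depth t \<le> k \<and> (\<forall>X\<in>{X \<in> D. q \<notin> X}. X \<inter> Q = Z \<longrightarrow> dt_eval t X = g X)"
      by auto
  qed
  moreover have "\<exists>t. dt_depth t \<le> k + card Q \<and> (\<forall>X\<in>{X \<in> D. q \<in> X}. dt_eval t X = g X)"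
  proof (rule insert.IH)
    fix Z assume "Z \<subseteq> Q"
    then obtain t where "dt_depth t \<le> k" "\<forall>X\<in>D. X \<inter> insert q Q = insert q Z \<longrightarrow> dt_eval t X = g X"
      using insert.prems[of "insert q Z"] by blast
    then show "\<exists>t. dt_depth t \<le> k \<and> (\<forall>X\<in>{X \<in> D. q \<in> X}. X \<inter> Q = Z \<longrightarrow> dt_eval t X = g X)"
      by auto
  qed
  ultimately obtain s t where
    "dt_depth s \<le> k + card Q" "\<forall>X\<in>{X \<in> D. q \<notin> X}. dt_eval s X = g X"
    "dt_depth t \<le> k + card Q" "\<forall>X\<in>{X \<in> D. q \<in> X}. dt_eval t X = g X"
    by blast
  then show ?case
    using insert.hyps by (intro exI[of _ "Query q s t"]) auto
qed auto

text \<open>A set missing a maximal disjoint subfamily could be added to it. The empty set is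
  excluded because it meets nothing.\<close>

lemma maximal_disjoint_subfamily:
  assumes "finite \<F>" "{} \<notin> \<F>"
  shows "\<exists>\<M>. \<M> \<subseteq> \<F> \<and> pairwise disjnt \<M> \<and> (\<forall>S\<in>\<F>. S \<inter> \<Union>\<M> \<noteq> {})"
proof -
  let ?P = "{\<M> \<in> Pow \<F>. pairwise disjnt \<M>}"
  have "finite ?P" "{} \<in> ?P" using assms(1) by auto
  then obtain \<M> where \<M>: "\<M> \<in> ?P" "\<forall>\<N>\<in>?P. \<M> \<subseteq> \<N> \<longrightarrow> \<M> = \<N>"
    by (metis (no_types, lifting) empty_iff finite_has_maximal)
  have "S \<inter> \<Union>\<M> \<noteq> {}" if S: "S \<in> \<F>" for S
  proof
    assume *: "S \<inter> \<Union>\<M> = {}"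
    then have "insert S \<M> \<in> ?P" using \<M>(1) S by (auto simp: pairwise_insert disjnt_def)
    then have "\<M> = insert S \<M>" using \<M>(2) subset_insertI by metis
    then have "S \<in> \<M>" by blast
    then have "S \<subseteq> \<Union>\<M>" by blast
    then have "S = {}" using * by blast
    then show False using S assms(2) by simp
  qed
  then show ?thesis using \<M>(1) by blast
qed

text \<open>Coefficient families over arbitrary finite \<open>U\<close> are closed under fixing
  variables, as the induction on \<open>d\<close> requires. Querying \<open>Q\<close> costs at most
  \<open>4 * Suc d ^ 3\<close>, which added to \<open>4 * d ^ 4\<close> stays within
  \<open>4 * Suc d ^ 4\<close>.\<close>

lemma dtree_exists:
  fixes \<alpha> :: "'a set \<Rightarrow> real"
  assumes "finite U" and "\<And>S. S \<subseteq> U \<Longrightarrow> \<alpha> S \<noteq> 0 \<Longrightarrow> card S \<le> d"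
    and "\<And>X. X \<subseteq> U \<Longrightarrow> sum \<alpha> (Pow X) \<in> {-1, 1}"
  shows "\<exists>t. dt_depth t \<le> 4 * d ^ 4 \<and> (\<forall>X. dt_eval t X = sum \<alpha> (Pow (X \<inter> U)))"
  using assms
proof (induction d arbitrary: U \<alpha>)
  case 0
  have "sum \<alpha> (Pow (X \<inter> U)) = sum \<alpha> {{}}" for X
  proof (rule sum.mono_neutral_right)
    show "\<forall>S\<in>Pow (X \<inter> U) - {{}}. \<alpha> S = 0"
    proof
      fix S assume S: "S \<in> Pow (X \<inter> U) - {{}}"
      then have "finite S" using 0(1) finite_subset by blast
      then show "\<alpha> S = 0" using S 0(2)[of S] by auto
    qed
  qed (use 0(1) in auto)
  then show ?case by (intro exI[of _ "Leaf (\<alpha> {})"]) simp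
next
  case (Suc d)
  let ?\<F> = "{S \<in> Pow U. card S = Suc d \<and> \<alpha> S \<noteq> 0}"
  have fin: "finite ?\<F>" "{} \<notin> ?\<F>" using Suc.prems(1) by auto
  obtain \<M> where \<M>: "\<M> \<subseteq> ?\<F>" "pairwise disjnt \<M>"
    and hit: "\<forall>S\<in>?\<F>. S \<inter> \<Union>\<M> \<noteq> {}"
    using maximal_disjoint_subfamily[OF fin] by (elim exE conjE)
  have fin\<M>: "finite \<M>" using finite_subset[OF \<M>(1) fin(1)] .
  define Q where "Q = \<Union>\<M>"
  have \<M>D: "M \<subseteq> U" "card M = Suc d" "\<alpha> M \<noteq> 0" if "M \<in> \<M>" for M
    using subsetD[OF \<M>(1) that] by auto
  have Q: "Q \<subseteq> U" using \<M>D(1) unfolding Q_def by blast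
  then have finQ: "finite Q" using Suc.prems(1) by (rule finite_subset)
  \<comment> \<open>The sensitive blocks inherit disjointness from the monomials containing them, so
    the block sensitivity bound limits the size of \<open>\<M>\<close>.\<close>
  have "\<exists>B\<subseteq>M. sum \<alpha> (Pow B) \<noteq> \<alpha> {}" if "M \<in> \<M>" for M
  proof -
    have "finite M" using finite_subset[OF \<M>D(1)[OF that] Suc.prems(1)] .
    moreover have "M \<noteq> {}" using \<M>D(2)[OF that] by auto
    ultimately show ?thesis using \<M>D(3)[OF that] by (rule sensitive_block_exists)
  qed
  then obtain B where B: "\<And>M. M \<in> \<M> \<Longrightarrow> B M \<subseteq> M"
      "\<And>M. M \<in> \<M> \<Longrightarrow> sum \<alpha> (Pow (B M)) \<noteq> \<alpha> {}"
    by metis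
  define l where "l x = (THE M. M \<in> \<M> \<and> x \<in> M)" for x
  have l: "l x = M" if "M \<in> \<M>" "x \<in> M" for x M
    unfolding l_def using that \<M>(2) by (intro the_equality) (auto simp: pairwise_def disjnt_iff)
  have lB: "l x = M" if "M \<in> \<M>" "x \<in> B M" for x M
    using l[OF that(1)] B(1)[OF that(1)] that(2) by blast
  have "card \<M> \<le> 4 * (Suc d) ^ 2"
  proof (rule block_sensitivity_le[OF Suc.prems, where V = "\<Union>(B ` \<M>)" and l = l])
    show "\<Union>(B ` \<M>) \<subseteq> U" using B(1) \<M>D(1) by blast
    show "l ` \<Union>(B ` \<M>) \<subseteq> \<M>" using lB by auto
    fix M assume M: "M \<in> \<M>"
    then have "{x \<in> \<Union>(B ` \<M>). l x = M} = B M" using lB by auto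
    then show "sum \<alpha> (Pow {x \<in> \<Union>(B ` \<M>). l x = M}) \<noteq> \<alpha> {}" using B(2)[OF M] by simp
  qed (use fin\<M> in auto)
  moreover have "card Q \<le> card \<M> * Suc d"
  proof -
    have "card Q \<le> (\<Sum>M\<in>\<M>. card M)" unfolding Q_def by (rule card_Union_le_sum_card)
    also have "\<dots> = (\<Sum>M\<in>\<M>. Suc d)" using \<M>D(2) by (rule sum.cong[OF refl])
    finally show ?thesis by simp
  qed
  ultimately have "card Q \<le> 4 * Suc d ^ 2 * Suc d"
    using mult_le_mono1 order.trans by blast
  then have cardQ: "card Q \<le> 4 * Suc d ^ 3"
    by (simp only: power3_eq_cube power2_eq_square mult.assoc)
  have "\<exists>t. dt_depth t \<le> 4 * d ^ 4 + card Q \<and> (\<forall>X\<in>UNIV. dt_eval t X = sum \<alpha> (Pow (X \<inter> U)))"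
  proof (rule dtree_query_all[OF finQ])
    fix Z assume Z: "Z \<subseteq> Q"
    then have finZ: "finite Z" using finQ by (rule finite_subset)
    \<comment> \<open>\<open>\<beta>\<close> are the coefficients of the restriction that fixes the variables in \<open>Q\<close> to \<open>Z\<close>.\<close>
    define \<beta> where "\<beta> S = (\<Sum>R\<in>Pow Z. \<alpha> (S \<union> R))" for S
    have sum_\<beta>: "sum \<beta> (Pow X) = sum \<alpha> (Pow (X \<union> Z))" if "X \<subseteq> U - Q" for X
      unfolding \<beta>_def by (rule sum_Pow_Un[symmetric]) (use that Z in blast)
    have "\<exists>t. dt_depth t \<le> 4 * d ^ 4 \<and> (\<forall>X. dt_eval t X = sum \<beta> (Pow (X \<inter> (U - Q))))"
    proof (rule Suc.IH)
      show "finite (U - Q)" using Suc.prems(1) by simp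
      show "sum \<beta> (Pow X) \<in> {-1, 1}" if "X \<subseteq> U - Q" for X
      proof -
        have "X \<union> Z \<subseteq> U" using that Z Q by blast
        then show ?thesis unfolding sum_\<beta>[OF that] by (rule Suc.prems(3))
      qed
      fix S assume S: "S \<subseteq> U - Q" "\<beta> S \<noteq> 0"
      then obtain R where R: "R \<subseteq> Z" "\<alpha> (S \<union> R) \<noteq> 0"
        unfolding \<beta>_def by (auto elim: sum.not_neutral_contains_not_neutral)
      have sub: "S \<union> R \<subseteq> U" using S(1) R(1) Z Q by blast
      then have fin: "finite (S \<union> R)" using Suc.prems(1) by (rule finite_subset)
      have le: "card (S \<union> R) \<le> Suc d" using Suc.prems(2) sub R(2) by blast
      show "card S \<le> d"
      proof (rule ccontr)
        \<comment> \<open>Such an \<open>S\<close> already exhausts the degree, so \<open>R\<close>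
          adds nothing and \<open>S\<close> is a top-degree monomial of \<open>\<alpha>\<close>
          avoiding \<open>Q\<close>, against maximality.\<close>
        assume "\<not> card S \<le> d"
        then have "S \<union> R = S" using le fin by (intro card_seteq[symmetric]) auto
        then have "S \<in> ?\<F>" using R(2) le \<open>\<not> card S \<le> d\<close> sub by auto
        then show False using bspec[OF hit] S(1) by (auto simp: Q_def)
      qed
    qed
    then obtain t where t: "dt_depth t \<le> 4 * d ^ 4"
      "\<And>X. dt_eval t X = sum \<beta> (Pow (X \<inter> (U - Q)))" by blast
    have "dt_eval t X = sum \<alpha> (Pow (X \<inter> U))" if "X \<inter> Q = Z" for X
    proof -
      have "X \<inter> (U - Q) \<union> Z = X \<inter> U" using that Q by auto
      then show ?thesis using t(2)[of X] sum_\<beta>[of "X \<inter> (U - Q)"] by auto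
    qed
    then show "\<exists>t. dt_depth t \<le> 4 * d ^ 4 \<and>
        (\<forall>X\<in>UNIV. X \<inter> Q = Z \<longrightarrow> dt_eval t X = sum \<alpha> (Pow (X \<inter> U)))"
      using t(1) by blast
  qed
  moreover have "4 * d ^ 4 + card Q \<le> 4 * Suc d ^ 4"
  proof -
    have power4: "x ^ 4 = x * x ^ 3" for x :: nat
      by (simp add: power4_eq_xxxx power3_eq_cube)
    have "d * d ^ 3 \<le> d * Suc d ^ 3" by (intro mult_le_mono2 power_mono) auto
    then have "d ^ 4 + Suc d ^ 3 \<le> Suc d ^ 4" unfolding power4 mult_Suc by linarith
    then show ?thesis using cardQ by linarith
  qed
  ultimately show ?case using order.trans by blast
qed

text \<open>Each query takes two bits, Alice's coordinate and then Bob's; \<open>h\<close> of the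
  two selects the subtree. The output bit is not consulted, as it is announced beforehand and
  decides which \<open>h\<close> is used.\<close>

primrec simulate :: "(bool \<Rightarrow> bool \<Rightarrow> bool) \<Rightarrow> (nat, 'o) dtree \<Rightarrow> (bool list \<times> bool, bool list, 'o) protocol"
  where
  "simulate h (Leaf z) = Output z"
| "simulate h (Query i s t) =
     Alice (\<lambda>(x, b). i \<in> ones x)
       (Bob (\<lambda>y. i \<in> ones y)
         (if h False False then simulate h t else simulate h s)
         (if h False True then simulate h t else simulate h s))
       (Bob (\<lambda>y. i \<in> ones y)
         (if h True False then simulate h t else simulate h s)
         (if h True True then simulate h t else simulate h s))"

lemma run_simulate: "run (simulate h t) (x, b) y = dt_eval t {i. h (i \<in> ones x) (i \<in> ones y)}"
  by (induction t) auto

lemma cost_simulate: "cost (simulate h t) \<le> 2 * dt_depth t"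
  by (induction t) auto

lemma comm_complexity_and_or_le:
  assumes f: "\<And>x. x \<in> set (cube n) \<Longrightarrow> f x \<in> {-1, 1}"
  shows "comm_complexity (set (alice_inputs n)) (set (cube n)) (and_or_problem f)
    \<le> 1 + 8 * cube_degree n f ^ 4"
proof -
  let ?\<alpha> = "multilinear_coeff n f" and ?d = "cube_degree n f"
  have "\<exists>t. dt_depth t \<le> 4 * ?d ^ 4 \<and> (\<forall>X. dt_eval t X = sum ?\<alpha> (Pow (X \<inter> {..<n})))"
  proof (rule dtree_exists)
    fix X assume "X \<subseteq> {..<n}"
    then have "X \<in> ones ` set (cube n)" using bij_betw_ones[of n] by (simp add: bij_betw_def)
    then obtain x where "x \<in> set (cube n)" "ones x = X" by blast
    then show "sum ?\<alpha> (Pow X) \<in> {-1, 1}"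
      using f[of x] eval_multilinear_coeff[of x n f] by simp
  qed (auto intro: card_le_cube_degree)
  then obtain t where t: "dt_depth t \<le> 4 * ?d ^ 4"
    "\<And>X. dt_eval t X = sum ?\<alpha> (Pow (X \<inter> {..<n}))" by blast
  have eval: "dt_eval t (ones z) = f z" if "z \<in> set (cube n)" for z
    using eval_multilinear_coeff[OF that, of f] ones_subset[OF that] by (simp add: t(2) Int_absorb2)
  \<comment> \<open>One bit announces the wanted output; the same tree then runs under AND or OR at
    two bits per query.\<close>
  define P where "P = Alice snd (simulate (\<and>) t) (simulate (\<or>) t)"
  have "computes P (set (alice_inputs n)) (set (cube n)) (and_or_problem f)"
    unfolding computes_def
  proof (intro ballI)
    fix xb y assume "xb \<in> set (alice_inputs n)" and y: "y \<in> set (cube n)"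
    then obtain x b where xb: "xb = (x, b)" and x: "x \<in> set (cube n)"
      by (auto simp: alice_inputs_def)
    have len: "length x = length y" using x y by (simp add: set_cube)
    have "{i. i \<in> ones x \<and> i \<in> ones y} = ones (bit_and x y)"
      "{i. i \<in> ones x \<or> i \<in> ones y} = ones (bit_or x y)"
      by (auto simp: ones_bit_and[OF len] ones_bit_or[OF len])
    then show "run P xb y = and_or_problem f xb y"
      using bit_in_cube[OF x y] by (simp add: P_def xb run_simulate eval and_or_problem_def)
  qed
  then have "comm_complexity (set (alice_inputs n)) (set (cube n)) (and_or_problem f) \<le> cost P"
    unfolding comm_complexity_def by (intro Least_le) blast
  also have "\<dots> \<le> 1 + 2 * dt_depth t"
    using cost_simulate[of "(\<and>)" t] cost_simulate[of "(\<or>)" t] by (simp add: P_def)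
  also have "\<dots> \<le> 1 + 8 * ?d ^ 4" using t(1) by simp
  finally show ?thesis .
qed

section \<open>Numerical estimates and conclusion\<close>

lemma sqrt2_power_le:
  assumes "(2 :: nat) ^ d \<le> a * b" "a \<le> r" "b \<le> r"
  shows "sqrt 2 ^ d \<le> real r"
proof -
  have "(2 :: nat) ^ d \<le> r * r" using assms mult_le_mono order.trans by blast
  then have "real (2 ^ d) \<le> real (r * r)" by (rule of_nat_mono)
  then have "(sqrt 2 ^ d)\<^sup>2 \<le> (real r)\<^sup>2"
    by (simp add: power2_eq_square flip: power_mult_distrib)
  then show ?thesis by (rule power2_le_imp_le) simp
qed

text \<open>For \<open>L \<le> 2\<close> the left side is at most
  \<open>1 + 128 * 2 ^ 4 = 2049\<close>. For larger \<open>L\<close> the factor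
  \<open>128 = 2 ^ 7\<close> is absorbed into \<open>L ^ 7\<close>, and raising the exponent from 11
  to 2049 only enlarges the power. One constant has to serve as exponent and as summand.\<close>

lemma quartic_le_powr:
  fixes L :: real
  assumes "0 \<le> L"
  shows "1 + 128 * L ^ 4 \<le> L powr 2049 + 2049"
proof (cases "L \<le> 2")
  case True
  then have "L ^ 4 \<le> 2 ^ 4" using assms by (intro power_mono)
  then have "128 * L ^ 4 \<le> 2048" by simp
  then show ?thesis using powr_ge_zero[of L 2049] by linarith
next
  case False
  have "128 * L ^ 4 = 2 ^ 7 * L ^ 4" by simp
  also have "\<dots> \<le> L ^ 7 * L ^ 4" using False by (intro mult_right_mono power_mono) auto
  also have "\<dots> = L powr 11" using False by (simp add: powr_numeral flip: power_add)
  also have "\<dots> \<le> L powr 2049" using False by (intro powr_mono) auto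
  finally show ?thesis by simp
qed

theorem theorem6p4:
  shows
    "(\<forall>(n::nat) (f :: bool list \<Rightarrow> real).
        n \<ge> 1 \<longrightarrow> (\<forall>x\<in>set (cube n). f x \<in> {-1, 1}) \<longrightarrow>
        real (max (comm_rank (cube n) (cube n) (\<lambda>x y. f (bit_and x y)))
                  (comm_rank (cube n) (cube n) (\<lambda>x y. f (bit_or x y))))
          \<ge> (3 / (2 * sqrt 2)) ^ cube_degree n f \<and>
        (3 / (2 * sqrt 2)) ^ cube_degree n f \<ge> (1.06 :: real) ^ cube_degree n f) \<and>
     (\<exists>c::real. c > 0 \<and>
        (\<forall>(n::nat) (f :: bool list \<Rightarrow> real).
           n \<ge> 1 \<longrightarrow> (\<forall>x\<in>set (cube n). f x \<in> {-1, 1}) \<longrightarrow>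
           real (comm_complexity (set (alice_inputs n)) (set (cube n)) (and_or_problem f))
             \<le> (log 2 (real (comm_rank (alice_inputs n) (cube n) (and_or_problem f)))) powr c + c))"
proof (intro conjI allI impI)
  fix n and f :: "bool list \<Rightarrow> real"
  assume "\<forall>x\<in>set (cube n). f x \<in> {-1, 1}"
  moreover have f: "replicate n False \<in> set (cube n)" by (simp add: set_cube)
  ultimately have f0: "f (replicate n False) \<noteq> 0" by fastforce
  let ?d = "cube_degree n f"
  let ?r = "max (comm_rank (cube n) (cube n) (\<lambda>x y. f (bit_and x y)))
                (comm_rank (cube n) (cube n) (\<lambda>x y. f (bit_or x y)))"
  have id: "bij_betw (\<lambda>x. x) (set (cube n)) (set (cube n))" by (simp add: bij_betw_def)
  have "monomials n f \<le> ?r"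
    by (rule max.coboundedI1, rule monomials_le_comm_rank[OF distinct_cube subset_refl id]) (rule refl)
  moreover have "comonomials n f \<le> ?r"
    by (rule max.coboundedI2, rule comonomials_le_comm_rank[OF distinct_cube subset_refl id]) (rule refl)
  ultimately have "sqrt 2 ^ ?d \<le> real ?r"
    by (rule sqrt2_power_le[OF degree_le_monomials[of _ n f, OF f f0]])
  \<comment> \<open>The base \<open>sqrt 2\<close> obtained above is larger than the one
    claimed.\<close>
  moreover have "3 / (2 * sqrt 2) \<le> sqrt 2"
  proof (subst pos_divide_le_eq)
    have "sqrt 2 * (2 * sqrt 2) = 4" by (simp add: mult.left_commute[of "sqrt 2" 2])
    then show "3 \<le> sqrt 2 * (2 * sqrt 2)" by linarith
  qed simp
  then have "(3 / (2 * sqrt 2)) ^ ?d \<le> sqrt 2 ^ ?d" by (rule power_mono) simp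
  ultimately show "(3 / (2 * sqrt 2)) ^ ?d \<le> real ?r" by linarith
  \<comment> \<open>Here \<open>2.12 = 2 * 1.06\<close>, and the square of \<open>3 / 2.12\<close>
    is slightly above 2.\<close>
  have "sqrt 2 \<le> 3 / 2.12"
    by (rule real_le_lsqrt) (auto simp: power2_eq_square)
  then show "(1.06 :: real) ^ ?d \<le> (3 / (2 * sqrt 2)) ^ ?d"
    by (intro power_mono) (auto simp: field_simps)
next
  show "\<exists>c::real. c > 0 \<and>
        (\<forall>(n::nat) (f :: bool list \<Rightarrow> real).
           n \<ge> 1 \<longrightarrow> (\<forall>x\<in>set (cube n). f x \<in> {-1, 1}) \<longrightarrow>
           real (comm_complexity (set (alice_inputs n)) (set (cube n)) (and_or_problem f))
             \<le> (log 2 (real (comm_rank (alice_inputs n) (cube n) (and_or_problem f)))) powr c + c)"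
  proof (intro exI[of _ 2049] conjI allI impI)
    fix n and f :: "bool list \<Rightarrow> real"
    assume f: "\<forall>x\<in>set (cube n). f x \<in> {-1, 1}"
    let ?d = "cube_degree n f" and ?r = "comm_rank (alice_inputs n) (cube n) (and_or_problem f)"
    define L where "L = log 2 (real ?r)"
    have x: "replicate n False \<in> set (cube n)" by (simp add: set_cube)
    then have f0: "f (replicate n False) \<noteq> 0" using f by fastforce
    have dist: "distinct (alice_inputs n)"
      by (simp add: alice_inputs_def distinct_product distinct_cube)
    \<comment> \<open>Rows with output bit \<open>False\<close> form the AND matrix and those with
      \<open>True\<close> the OR matrix, so both ranks are bounded by that of the full
      problem.\<close>
    have rows: "set (cube n) \<times> {b} \<subseteq> set (alice_inputs n)" for b
      by (auto simp: alice_inputs_def)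
    have bij: "bij_betw fst (set (cube n) \<times> {b}) (set (cube n))" for b :: bool
      by (auto simp: bij_betw_def inj_on_def)
    have "monomials n f \<le> ?r"
      by (rule monomials_le_comm_rank[OF dist rows[of False] bij]) (auto simp: and_or_problem_def)
    moreover have "comonomials n f \<le> ?r"
      by (rule comonomials_le_comm_rank[OF dist rows[of True] bij]) (auto simp: and_or_problem_def)
    ultimately have r: "sqrt 2 ^ ?d \<le> real ?r"
      using sqrt2_power_le[OF degree_le_monomials[of _ n f, OF x f0]] by blast
    have "log 2 (sqrt 2 ^ ?d) \<le> L"
      unfolding L_def by (rule log_mono) (use r in auto)
    \<comment> \<open>The binary logarithm of \<open>sqrt 2\<close> is 1/2; this bound turns
      \<open>8 * d ^ 4\<close> into \<open>128 * L ^ 4\<close> below.\<close>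
    then have dL: "real ?d \<le> 2 * L"
      by (simp add: log_nat_power) (simp add: log_def ln_sqrt)
    have "real (comm_complexity (set (alice_inputs n)) (set (cube n)) (and_or_problem f))
        \<le> real (1 + 8 * ?d ^ 4)"
      using f by (intro of_nat_mono comm_complexity_and_or_le) blast
    also have "\<dots> = 1 + 8 * real ?d ^ 4" by simp
    also have "\<dots> \<le> 1 + 8 * (2 * L) ^ 4"
      using dL by (intro add_left_mono mult_left_mono power_mono) auto
    also have "\<dots> = 1 + 128 * L ^ 4" by (simp add: power_mult_distrib)
    also have "\<dots> \<le> L powr 2049 + 2049" using dL by (intro quartic_le_powr) linarith
    finally show "real (comm_complexity (set (alice_inputs n)) (set (cube n)) (and_or_problem f))
        \<le> log 2 (real ?r) powr 2049 + 2049"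
      unfolding L_def .
  qed simp
qed

end
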